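(* Let $A$ be a closed densely defined symmetric operator with equal deficiency indices in a separable Hilbert space $\mathfrak H$, let $\{\mathcal H,\Gamma_0,\Gamma_1\}$ be a boundary triplet for $A^*$ with Weyl function $M(z)$, let $B\in[\mathcal H]$ with $\ker B_I=\{0\}$, where $B_I=(B-B^* )/2i$, and let $A_B$ be the almost solvable extension of $A$ with $\operatorname{dom}(A_B)=\ker(\Gamma_1-B\Gamma_0)$ (so that $A_B$ and $A_B^*=A_{B^*}$ are disjoint). Let $\mathcal E$ be the Hilbert space obtained from $\mathcal H$ with the norm $\|f\|_{\mathcal E}=\||B_I|^{1/2}f\|_{\mathcal H}$, let $J=\operatorname{sign}B_I$, and take the boundary operators $\Gamma=\Gamma_0|_{\operatorname{dom}(A_B)}$ for $A_B$ and $\Gamma'=\Gamma_0|_{\operatorname{dom}(A_{B^*})}$ for $-A_B^*$, both acting into $\mathcal E$. Then the characteristic function $W(z)$ of $A_B$ corresponding to these boundary operators is holomorphic on $\rho(A_{B^*})$, takes values in $[\mathcal E]$, and is given by $$W(z)=(B^*-M(z))^{-1}(B-M(z)).$$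
   Context: $[\mathcal K]$ denotes the bounded everywhere defined operators on $\mathcal K$. A boundary triplet for $A^*$ is a triple $\{\mathcal H,\Gamma_0,\Gamma_1\}$, where $\mathcal H$ is a Hilbert space and $\Gamma_0,\Gamma_1:\operatorname{dom}(A^* )\to\mathcal H$ are linear maps such that (i) $(A^*f,g)_{\mathfrak H}-(f,A^*g)_{\mathfrak H}=(\Gamma_1f,\Gamma_0g)_{\mathcal H}-(\Gamma_0f,\Gamma_1g)_{\mathcal H}$ for all $f,g\in\operatorname{dom}(A^* )$, and (ii) $f\mapsto(\Gamma_1f,\Gamma_0f)$ maps $\operatorname{dom}(A^* )$ onto $\mathcal H\oplus\mathcal H$. With $A_0=A^*|_{\ker\Gamma_0}$ (self-adjoint), the Weyl function is the $[\mathcal H]$-valued function $M(z)$, $z\in\rho(A_0)$, defined by $M(z)\Gamma_0f_z=\Gamma_1f_z$ for $f_z\in\ker(A^*-z)$. The formula for $W(z)$ is understood at points $z\in\rho(A_{B^*})\cap\rho(A_0)$, where $M(z)$ is defined, as an identity on $\mathcal H$ (which is dense in $\mathcal E$). Two proper extensions are disjoint if the intersection of their domains is $\operatorname{dom}(A)$. Boundary operators. Let $\widetilde A$ be a proper extension of $A$ ($A\subset\widetilde A\subset A^*$) and $\mathcal E$ a Hilbert space with the indefinite inner product $[f,g]_{\mathcal E}=(Jf,g)_{\mathcal E}$, $J=J^*=J^{-1}$. A linear operator $\Gamma:\operatorname{dom}(\widetilde A)\to\mathcal E$ with dense range is a boundary operator for $\widetilde A$ if $(\widetilde Af,g)-(f,\widetilde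 Ag)=2i[\Gamma f,\Gamma g]_{\mathcal E}$ for all $f,g\in\operatorname{dom}(\widetilde A)$. Let $\Gamma'$ be a boundary operator for $-\widetilde A^*$, acting from $\operatorname{dom}(\widetilde A^* )$ into $\mathcal E'$. The characteristic function $W(z)$ of $\widetilde A$, $z\in\rho(\widetilde A^* )$, is defined by $W(z)\Gamma f=\Gamma'g_z$, $f\in\operatorname{dom}(\widetilde A)$, where $g_z\in\operatorname{dom}(\widetilde A^* )$ is the solution of $(\widetilde A^*-z)g_z=(\widetilde A-z)f$; it is extended to the whole space by continuity. In the claim, $\mathcal E=\mathcal E'$ is the completion of $\mathcal H$ in the indicated norm and $J=\operatorname{sign}B_I$ is extended to $\mathcal E$ by continuity; the operators $\Gamma,\Gamma'$ given there are boundary operators for $A_B$ and $-A_B^*$. *)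

theory Defs
  imports "HOL-Analysis.Analysis" "HOL-Library.Equipollence"
begin

section \<open>Complex Hilbert spaces\<close>

text \<open>The inner product is linear in the first argument and conjugate linear in the second one.\<close>

class complex_hilbert = banach +
  fixes scaleC :: "complex \<Rightarrow> 'a \<Rightarrow> 'a"  (infixr \<open>*\<^sub>C\<close> 75)
    and cinner :: "'a \<Rightarrow> 'a \<Rightarrow> complex"
  assumes scaleC_add_right: "c *\<^sub>C (x + y) = c *\<^sub>C x + c *\<^sub>C y"
    and scaleC_add_left: "(c + d) *\<^sub>C x = c *\<^sub>C x + d *\<^sub>C x"
    and scaleC_scaleC: "c *\<^sub>C (d *\<^sub>C x) = (c * d) *\<^sub>C x"
    and scaleR_scaleC: "r *\<^sub>R x = complex_of_real r *\<^sub>C x"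
    and cinner_commute: "cinner x y = cnj (cinner y x)"
    and cinner_add_left: "cinner (x + y) w = cinner x w + cinner y w"
    and cinner_scaleC_left: "cinner (c *\<^sub>C x) y = c * cinner x y"
    and cinner_self: "cinner x x = complex_of_real ((norm x)\<^sup>2)"

instantiation complex :: complex_hilbert
begin

definition scaleC_complex :: "complex \<Rightarrow> complex \<Rightarrow> complex" where
  "scaleC_complex c x = c * x"

definition cinner_complex :: "complex \<Rightarrow> complex \<Rightarrow> complex" where
  "cinner_complex x y = x * cnj y"

instance
  by standard
    (simp_all add: scaleC_complex_def cinner_complex_def algebra_simps scaleR_conv_of_real
      complex_norm_square[symmetric] del: of_real_power)

end

definition clinear_on :: "'a::complex_hilbert set \<Rightarrow> ('a \<Rightarrow> 'b::complex_hilbert) \<Rightarrow> bool" where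
  "clinear_on V T \<longleftrightarrow>
     (\<forall>x\<in>V. \<forall>y\<in>V. T (x + y) = T x + T y) \<and> (\<forall>c. \<forall>x\<in>V. T (c *\<^sub>C x) = c *\<^sub>C T x)"

section \<open>Bounded everywhere defined operators\<close>

definition bounded_clinear :: "('a::complex_hilbert \<Rightarrow> 'b::complex_hilbert) \<Rightarrow> bool" where
  "bounded_clinear T \<longleftrightarrow> bounded_linear T \<and> (\<forall>c x. T (c *\<^sub>C x) = c *\<^sub>C T x)"

definition cadjoint :: "('a::complex_hilbert \<Rightarrow> 'a) \<Rightarrow> 'a \<Rightarrow> 'a" where
  "cadjoint T = (THE S. \<forall>x y. cinner (T x) y = cinner x (S y))"

definition im_part :: "('a::complex_hilbert \<Rightarrow> 'a) \<Rightarrow> 'a \<Rightarrow> 'a" where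
  "im_part B = (\<lambda>x. (1 / (2 * \<i>)) *\<^sub>C (B x - cadjoint B x))"

definition positive_op :: "('a::complex_hilbert \<Rightarrow> 'a) \<Rightarrow> bool" where
  "positive_op P \<longleftrightarrow> bounded_clinear P \<and> (\<forall>x. cinner (P x) x \<in> \<real>\<^sub>\<ge>\<^sub>0)"

definition sqrt_op :: "('a::complex_hilbert \<Rightarrow> 'a) \<Rightarrow> 'a \<Rightarrow> 'a" where
  "sqrt_op P = (THE S. positive_op S \<and> S \<circ> S = P)"

definition abs_op :: "('a::complex_hilbert \<Rightarrow> 'a) \<Rightarrow> 'a \<Rightarrow> 'a" where
  "abs_op T = sqrt_op (cadjoint T \<circ> T)"

text \<open>For self-adjoint \<open>T\<close>, the operator \<open>sign T\<close> (with \<open>sign 0 = 0\<close>) is the partial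
  isometry of the polar decomposition \<open>T = sign T |T|\<close>.\<close>

definition sign_op :: "('a::complex_hilbert \<Rightarrow> 'a) \<Rightarrow> 'a \<Rightarrow> 'a" where
  "sign_op T = (THE U. bounded_clinear U \<and> (\<forall>x. U (abs_op T x) = T x) \<and>
                       (\<forall>x. T x = 0 \<longrightarrow> U x = 0))"

text \<open>Holomorphy of a function with values in the bounded operators, with respect to the
  operator norm.\<close>

definition op_holomorphic_on ::
    "(complex \<Rightarrow> 'a::complex_hilbert \<Rightarrow> 'b::complex_hilbert) \<Rightarrow> complex set \<Rightarrow> bool" where
  "op_holomorphic_on W S \<longleftrightarrow>
     (\<forall>z\<in>S. bounded_clinear (W z)) \<and>
     (\<forall>z\<in>S. \<exists>D. bounded_clinear D \<and>
        ((\<lambda>w. onorm (\<lambda>x. (1 / (w - z)) *\<^sub>C (W w x - W z x) - D x)) \<longlongrightarrow> 0) (at z within S))"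

section \<open>Unbounded operators\<close>

text \<open>An unbounded operator is identified with its graph: \<open>(f, f') \<in> A\<close> means that \<open>f\<close> is in the
  domain and \<open>A f = f'\<close>. Inclusion of graphs is extension of operators, the domain is
  \<^const>\<open>Domain\<close>, and closedness is topological closedness of the graph.\<close>

definition linear_operator :: "('a::complex_hilbert \<times> 'a) set \<Rightarrow> bool" where
  "linear_operator A \<longleftrightarrow> single_valued A \<and> (0, 0) \<in> A \<and>
     (\<forall>(f, f')\<in>A. \<forall>(g, g')\<in>A. (f + g, f' + g') \<in> A) \<and>
     (\<forall>c. \<forall>(f, f')\<in>A. (c *\<^sub>C f, c *\<^sub>C f') \<in> A)"

definition op_adjoint :: "('a::complex_hilbert \<times> 'a) set \<Rightarrow> ('a \<times> 'a) set" where
  "op_adjoint A = {(g, g'). \<forall>(f, f')\<in>A. cinner f' g = cinner f g'}"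

definition op_neg :: "('a::complex_hilbert \<times> 'a) set \<Rightarrow> ('a \<times> 'a) set" where
  "op_neg A = {(f, - f') | f f'. (f, f') \<in> A}"

definition closed_densely_defined_symmetric :: "('a::complex_hilbert \<times> 'a) set \<Rightarrow> bool" where
  "closed_densely_defined_symmetric A \<longleftrightarrow>
     linear_operator A \<and> closed A \<and> closure (Domain A) = UNIV \<and> A \<subseteq> op_adjoint A"

text \<open>In \<open>resolvent_set\<close>, the operator \<open>R\<close> is \<open>(A - z)\<^sup>-\<^sup>1\<close>: the condition says that
  \<open>(A - z) f = y\<close> if and only if \<open>f = R y\<close>.\<close>

definition resolvent_set :: "('a::complex_hilbert \<times> 'a) set \<Rightarrow> complex set" where
  "resolvent_set A = {z. \<exists>R. bounded_clinear R \<and> (\<forall>f y. (f, y + z *\<^sub>C f) \<in> A \<longleftrightarrow> f = R y)}"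

definition op_kernel :: "('a::complex_hilbert \<times> 'a) set \<Rightarrow> complex \<Rightarrow> 'a set" where
  "op_kernel A z = {f. (f, z *\<^sub>C f) \<in> A}"

definition orthonormal_basis_of :: "'a::complex_hilbert set \<Rightarrow> 'a set \<Rightarrow> bool" where
  "orthonormal_basis_of S N \<longleftrightarrow> S \<subseteq> N \<and>
     (\<forall>x\<in>S. \<forall>y\<in>S. cinner x y = (if x = y then 1 else 0)) \<and>
     (\<forall>x\<in>N. (\<forall>s\<in>S. cinner x s = 0) \<longrightarrow> x = 0)"

text \<open>The deficiency indices are the Hilbert space dimensions of the kernels of \<open>A\<^sup>* - i\<close> and
  \<open>A\<^sup>* + i\<close>.\<close>

definition equal_deficiency_indices :: "('a::complex_hilbert \<times> 'a) set \<Rightarrow> bool" where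
  "equal_deficiency_indices A \<longleftrightarrow>
     (\<exists>S T. orthonormal_basis_of S (op_kernel (op_adjoint A) \<i>) \<and>
            orthonormal_basis_of T (op_kernel (op_adjoint A) (- \<i>)) \<and> S \<approx> T)"

definition proper_extension ::
    "('a::complex_hilbert \<times> 'a) set \<Rightarrow> ('a \<times> 'a) set \<Rightarrow> bool" where
  "proper_extension A T \<longleftrightarrow> linear_operator T \<and> A \<subseteq> T \<and> T \<subseteq> op_adjoint A"

definition disjoint_extensions ::
    "('a::complex_hilbert \<times> 'a) set \<Rightarrow> ('a \<times> 'a) set \<Rightarrow> ('a \<times> 'a) set \<Rightarrow> bool" where
  "disjoint_extensions A T1 T2 \<longleftrightarrow> Domain T1 \<inter> Domain T2 = Domain A"

section \<open>Boundary triplets and Weyl functions\<close>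

text \<open>The values of the boundary maps outside the domain of \<open>A\<^sup>*\<close> are never used.\<close>

definition boundary_triplet ::
    "('a::complex_hilbert \<times> 'a) set \<Rightarrow> ('a \<Rightarrow> 'h::complex_hilbert) \<Rightarrow> ('a \<Rightarrow> 'h) \<Rightarrow> bool" where
  "boundary_triplet A \<Gamma>\<^sub>0 \<Gamma>\<^sub>1 \<longleftrightarrow>
     clinear_on (Domain (op_adjoint A)) \<Gamma>\<^sub>0 \<and> clinear_on (Domain (op_adjoint A)) \<Gamma>\<^sub>1 \<and>
     (\<forall>(f, f')\<in>op_adjoint A. \<forall>(g, g')\<in>op_adjoint A.
        cinner f' g - cinner f g' = cinner (\<Gamma>\<^sub>1 f) (\<Gamma>\<^sub>0 g) - cinner (\<Gamma>\<^sub>0 f) (\<Gamma>\<^sub>1 g)) \<and>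
     (\<lambda>f. (\<Gamma>\<^sub>1 f, \<Gamma>\<^sub>0 f)) ` Domain (op_adjoint A) = UNIV"

definition ext_zero ::
    "('a::complex_hilbert \<times> 'a) set \<Rightarrow> ('a \<Rightarrow> 'h::complex_hilbert) \<Rightarrow> ('a \<times> 'a) set" where
  "ext_zero A \<Gamma>\<^sub>0 = {(f, f') \<in> op_adjoint A. \<Gamma>\<^sub>0 f = 0}"

definition ext_of ::
    "('a::complex_hilbert \<times> 'a) set \<Rightarrow> ('a \<Rightarrow> 'h::complex_hilbert) \<Rightarrow> ('a \<Rightarrow> 'h) \<Rightarrow> ('h \<Rightarrow> 'h)
      \<Rightarrow> ('a \<times> 'a) set" where
  "ext_of A \<Gamma>\<^sub>0 \<Gamma>\<^sub>1 B = {(f, f') \<in> op_adjoint A. \<Gamma>\<^sub>1 f - B (\<Gamma>\<^sub>0 f) = 0}"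

text \<open>Meaningful for \<open>z\<close> in the resolvent set of \<open>ext_zero A \<Gamma>\<^sub>0\<close>.\<close>

definition weyl_function ::
    "('a::complex_hilbert \<times> 'a) set \<Rightarrow> ('a \<Rightarrow> 'h::complex_hilbert) \<Rightarrow> ('a \<Rightarrow> 'h)
      \<Rightarrow> complex \<Rightarrow> 'h \<Rightarrow> 'h" where
  "weyl_function A \<Gamma>\<^sub>0 \<Gamma>\<^sub>1 z =
     (THE T. bounded_clinear T \<and> (\<forall>f\<in>op_kernel (op_adjoint A) z. T (\<Gamma>\<^sub>0 f) = \<Gamma>\<^sub>1 f))"

section \<open>Boundary operators and characteristic functions\<close>

definition fundamental_symmetry :: "('e::complex_hilbert \<Rightarrow> 'e) \<Rightarrow> bool" where
  "fundamental_symmetry J \<longleftrightarrow> bounded_clinear J \<and>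
     (\<forall>x y. cinner (J x) y = cinner x (J y)) \<and> J \<circ> J = id"

definition boundary_operator ::
    "('a::complex_hilbert \<times> 'a) set \<Rightarrow> ('a \<times> 'a) set \<Rightarrow> ('e::complex_hilbert \<Rightarrow> 'e)
      \<Rightarrow> ('a \<Rightarrow> 'e) \<Rightarrow> bool" where
  "boundary_operator A T J \<Gamma> \<longleftrightarrow>
     proper_extension A T \<and> fundamental_symmetry J \<and>
     clinear_on (Domain T) \<Gamma> \<and> closure (\<Gamma> ` Domain T) = UNIV \<and>
     (\<forall>(f, f')\<in>T. \<forall>(g, g')\<in>T. cinner f' g - cinner f g' = 2 * \<i> * cinner (J (\<Gamma> f)) (\<Gamma> g))"

text \<open>\<open>V\<close> is the value at \<open>z\<close> of the characteristic function of \<open>T\<close>: it is given by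
  \<open>V (\<Gamma> f) = \<Gamma>' g\<close> with \<open>(T\<^sup>* - z) g = (T - z) f\<close>, and by continuity outside the dense range
  of \<open>\<Gamma>\<close>.\<close>

definition is_characteristic_value ::
    "('a::complex_hilbert \<times> 'a) set \<Rightarrow> ('a \<Rightarrow> 'e::complex_hilbert) \<Rightarrow> ('a \<Rightarrow> 'k::complex_hilbert)
      \<Rightarrow> complex \<Rightarrow> ('e \<Rightarrow> 'k) \<Rightarrow> bool" where
  "is_characteristic_value T \<Gamma> \<Gamma>' z V \<longleftrightarrow>
     continuous_on UNIV V \<and>
     (\<forall>(f, f')\<in>T. \<forall>(g, g')\<in>op_adjoint T.
        g' - z *\<^sub>C g = f' - z *\<^sub>C f \<longrightarrow> V (\<Gamma> f) = \<Gamma>' g)"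

definition characteristic_function ::
    "('a::complex_hilbert \<times> 'a) set \<Rightarrow> ('a \<Rightarrow> 'e::complex_hilbert) \<Rightarrow> ('a \<Rightarrow> 'k::complex_hilbert)
      \<Rightarrow> complex \<Rightarrow> 'e \<Rightarrow> 'k" where
  "characteristic_function T \<Gamma> \<Gamma>' z = (THE V. is_characteristic_value T \<Gamma> \<Gamma>' z V)"

section \<open>Completions\<close>

text \<open>The Hilbert space \<open>'e\<close>, with the canonical embedding \<open>\<iota>\<close>, is the completion of \<open>'h\<close> with
  respect to the norm \<open>p\<close>.\<close>

definition is_completion ::
    "('h::complex_hilbert \<Rightarrow> real) \<Rightarrow> ('h \<Rightarrow> 'e::complex_hilbert) \<Rightarrow> bool" where
  "is_completion p \<iota> \<longleftrightarrow>
     clinear_on UNIV \<iota> \<and> (\<forall>h. norm (\<iota> h) = p h) \<and> closure (range \<iota>) = UNIV"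

definition extend_by_continuity ::
    "('h::complex_hilbert \<Rightarrow> 'e::complex_hilbert) \<Rightarrow> ('h \<Rightarrow> 'h) \<Rightarrow> 'e \<Rightarrow> 'e" where
  "extend_by_continuity \<iota> T = (THE F. continuous_on UNIV F \<and> (\<forall>h. F (\<iota> h) = \<iota> (T h)))"

end

theory Submission
  imports Defs
begin

text \<open>Write \<open>Y = \<Gamma>\<^sub>1 - B\<^sup>* \<Gamma>\<^sub>0\<close>, so that \<open>A\<^sub>B\<^sup>*\<close> is the restriction of \<open>A\<^sup>*\<close> to the kernel of \<open>Y\<close>. For
  \<open>z\<close> in its resolvent set, \<open>Y\<close> maps the kernel of \<open>A\<^sup>* - z\<close> bijectively onto \<open>\<H>\<close>; let \<open>Q(z)\<close> send
  \<open>Y u\<close> to \<open>\<Gamma>\<^sub>0 u\<close>, so that \<open>Q(z) = - (B\<^sup>* - M(z))\<^sup>-\<^sup>1\<close> wherever \<open>M(z)\<close> is defined. If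
  \<open>(A\<^sub>B\<^sup>* - z) g = (A\<^sub>B - z) f\<close>, then \<open>u = g - f\<close> lies in this kernel and \<open>Y u = - 2i B\<^sub>I \<Gamma>\<^sub>0 f\<close>, whence
  \<open>\<Gamma>\<^sub>0 g = (1 - 2i Q(z) B\<^sub>I) \<Gamma>\<^sub>0 f\<close>. As \<open>B\<^sub>I\<close> extends to a bounded operator \<open>L : \<E> \<rightarrow> \<H>\<close> and \<open>\<H>\<close> embeds
  boundedly into \<open>\<E>\<close> by \<open>\<iota>\<close>, \<open>W(z) = 1 - 2i \<iota> Q(z) L\<close> is bounded and inherits the holomorphy of \<open>Q\<close>,
  which comes from the resolvent identity.\<close>

section \<open>Complex Hilbert spaces\<close>

text \<open>\<open>M(z)\<close> is available only on the resolvent set of \<open>A0\<close>, which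
  may miss points of the resolvent set of \<open>ABstar\<close>. The characteristic function
  therefore cannot be read off the formula with \<open>M(z)\<close>; it is computed from
  \<open>Q(z)\<close>, and the formula becomes a comparison of two maps that are inverted on the
  same kernel. The extensions are in general not self-adjoint, so Green's identity is used in an
  asymmetric form, which pairs the maps describing an extension at \<open>z\<close> with those
  describing its adjoint at \<open>cnj z\<close>. The same theory, with
  \<open>\<Gamma>\<^sub>0\<close> in the role of \<open>Y\<close>, also yields \<open>M(z)\<close>.

  The other obstacle is the change of space. The norm of the completion is weaker, so a bounded
  operator on the original space need not extend to it. The product of \<open>Q(z)\<close> and
  \<open>B\<^sub>I\<close> does extend, because \<open>B\<^sub>I\<close> contains the square root
  that defines the new norm as a factor. The factor 2i is that of
  \<open>B - cadjoint B = 2i B\<^sub>I\<close>.\<close>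

lemma scaleC_one [simp]: "1 *\<^sub>C (x::'a::complex_hilbert) = x"
  using scaleR_scaleC[of 1 x] by simp

lemma scaleC_zero_left [simp]: "0 *\<^sub>C (x::'a::complex_hilbert) = 0"
  using scaleR_scaleC[of 0 x] by simp

lemma scaleC_zero_right [simp]: "c *\<^sub>C (0::'a::complex_hilbert) = 0"
  using scaleC_add_right[of c 0 "0::'a"] by simp

lemma scaleC_minus_right [simp]: "c *\<^sub>C (- x) = - (c *\<^sub>C (x::'a::complex_hilbert))"
  using scaleC_add_right[of c x "- x"] by (simp add: add_eq_0_iff)

lemma scaleC_minus_left [simp]: "(- c) *\<^sub>C x = - (c *\<^sub>C (x::'a::complex_hilbert))"
  using scaleC_add_left[of c "- c" x] by (simp add: add_eq_0_iff)

lemma scaleC_diff_right: "c *\<^sub>C (x - y) = c *\<^sub>C x - c *\<^sub>C (y::'a::complex_hilbert)"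
  using scaleC_add_right[of c x "- y"] by simp

lemma scaleC_diff_left: "(c - d) *\<^sub>C x = c *\<^sub>C x - d *\<^sub>C (x::'a::complex_hilbert)"
  using scaleC_add_left[of c "- d" x] by simp

lemma cinner_add_right: "cinner x (y + z) = cinner x y + cinner (x::'a::complex_hilbert) z"
  by (metis cinner_commute cinner_add_left complex_cnj_add)

lemma cinner_scaleC_right: "cinner x (c *\<^sub>C y) = cnj c * cinner (x::'a::complex_hilbert) y"
  by (metis cinner_commute cinner_scaleC_left complex_cnj_mult)

lemma cinner_zero_left [simp]: "cinner 0 (x::'a::complex_hilbert) = 0"
  using cinner_scaleC_left[of 0 x x] by simp

lemma cinner_zero_right [simp]: "cinner (x::'a::complex_hilbert) 0 = 0"
  using cinner_scaleC_right[of x 0 x] by simp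

lemma cinner_minus_left [simp]: "cinner (- x) y = - cinner (x::'a::complex_hilbert) y"
  using cinner_scaleC_left[of "-1" x y] by simp

lemma cinner_minus_right [simp]: "cinner x (- y) = - cinner (x::'a::complex_hilbert) y"
  using cinner_scaleC_right[of x "-1" y] by simp

lemma cinner_diff_left: "cinner (x - y) z = cinner x z - cinner (y::'a::complex_hilbert) z"
  using cinner_add_left[of x "- y" z] by simp

lemma cinner_diff_right: "cinner x (y - z) = cinner x y - cinner (x::'a::complex_hilbert) z"
  using cinner_add_right[of x y "- z"] by simp

lemmas cinner_simps = cinner_add_left cinner_add_right cinner_diff_left cinner_diff_right
  cinner_scaleC_left cinner_scaleC_right

lemma norm_sq_cinner: "(norm (x::'a::complex_hilbert))\<^sup>2 = Re (cinner x x)"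
  by (simp add: cinner_self)

lemma cinner_self_eq_0 [simp]: "cinner x x = 0 \<longleftrightarrow> (x::'a::complex_hilbert) = 0"
  by (simp add: cinner_self)

lemma norm_scaleC [simp]: "norm (c *\<^sub>C x) = cmod c * norm (x::'a::complex_hilbert)"
proof -
  have "(norm (c *\<^sub>C x))\<^sup>2 = Re ((c * cnj c) * cinner x x)"
    by (simp only: norm_sq_cinner cinner_scaleC_left cinner_scaleC_right mult_ac)
  also have "\<dots> = (cmod c * norm x)\<^sup>2"
    unfolding complex_norm_square[symmetric] cinner_self
    by (simp add: power_mult_distrib del: of_real_power)
  finally show ?thesis
    by (simp add: power2_eq_iff_nonneg)
qed

text \<open>With \<open>a = cinner x y\<close> the vector is the orthogonal projection of
  \<open>x\<close> onto the line through \<open>y\<close>. Both the Cauchy-Schwarz inequality and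
  the variational argument for projections need its length.\<close>

lemma norm_coeff_scaleC:
  assumes "y \<noteq> 0"
  shows "(norm ((a / of_real ((norm y)\<^sup>2)) *\<^sub>C y))\<^sup>2
    = (cmod a)\<^sup>2 / (norm (y::'a::complex_hilbert))\<^sup>2"
proof -
  have "norm ((a / of_real ((norm y)\<^sup>2)) *\<^sub>C y) = cmod a / norm y"
    using assms by (simp add: norm_divide power2_eq_square norm_mult del: of_real_power)
  then show ?thesis
    by (simp add: power_divide)
qed

lemma norm_add_sq:
  "(norm (x + y))\<^sup>2 = (norm x)\<^sup>2 + 2 * Re (cinner x y) + (norm (y::'a::complex_hilbert))\<^sup>2"
proof -
  have "Re (cinner y x) = Re (cinner x y)"
    using cinner_commute[of y x] by simp
  then show ?thesis
    by (simp add: norm_sq_cinner cinner_simps)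
qed

lemma norm_diff_sq:
  "(norm (x - y))\<^sup>2 = (norm x)\<^sup>2 - 2 * Re (cinner x y) + (norm (y::'a::complex_hilbert))\<^sup>2"
  using norm_add_sq[of x "- y"] by simp

lemma parallelogram:
  "(norm (x - y))\<^sup>2 + (norm (x + y))\<^sup>2 = 2 * (norm x)\<^sup>2 + 2 * (norm (y::'a::complex_hilbert))\<^sup>2"
  by (simp add: norm_add_sq norm_diff_sq)

text \<open>Cauchy-Schwarz: the squared distance from \<open>x\<close> to its projection
  \<open>c *\<^sub>C y\<close> is nonnegative.\<close>

lemma cinner_norm_le: "cmod (cinner x y) \<le> norm x * norm (y::'a::complex_hilbert)"
proof (cases "y = 0")
  case False
  define c where "c = cinner x y / of_real ((norm y)\<^sup>2)"
  have "cnj c * cinner x y = of_real ((cmod (cinner x y))\<^sup>2 / (norm y)\<^sup>2)"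
    by (simp add: c_def complex_norm_square mult.commute del: of_real_power)
  moreover have "(norm (c *\<^sub>C y))\<^sup>2 = (cmod (cinner x y))\<^sup>2 / (norm y)\<^sup>2"
    using False unfolding c_def by (rule norm_coeff_scaleC)
  ultimately have "0 \<le> (norm x)\<^sup>2 - (cmod (cinner x y))\<^sup>2 / (norm y)\<^sup>2"
    using zero_le_power2[of "norm (x - c *\<^sub>C y)"] unfolding norm_diff_sq cinner_scaleC_right
    by (simp del: zero_le_power2)
  then have "(cmod (cinner x y))\<^sup>2 \<le> (norm x * norm y)\<^sup>2"
    using False by (simp add: field_simps power_mult_distrib)
  then show ?thesis
    by (rule power2_le_imp_le) simp
qed simp

lemma bounded_bilinear_cinner: "bounded_bilinear (cinner :: 'a::complex_hilbert \<Rightarrow> _)"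
  by (rule bounded_bilinear.intro)
    (auto simp: cinner_simps scaleR_scaleC scaleC_complex_def intro!: exI[of _ 1] cinner_norm_le)

lemmas tendsto_cinner [tendsto_intros] = bounded_bilinear.tendsto[OF bounded_bilinear_cinner]
lemmas continuous_on_cinner [continuous_intros] =
  bounded_bilinear.continuous_on[OF bounded_bilinear_cinner]

lemma bounded_linear_scaleC: "bounded_linear ((*\<^sub>C) c :: 'a::complex_hilbert \<Rightarrow> 'a)"
  by (rule bounded_linear_intro[of _ "cmod c"])
    (auto simp: scaleC_add_right scaleR_scaleC scaleC_scaleC mult.commute)

lemmas tendsto_scaleC [tendsto_intros] = bounded_linear.tendsto[OF bounded_linear_scaleC]
lemmas continuous_on_scaleC [continuous_intros] =
  bounded_linear.continuous_on[OF bounded_linear_scaleC]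

lemma cinner_ext_right: "(\<And>x. cinner x y = cinner x z) \<Longrightarrow> (y::'a::complex_hilbert) = z"
  using cinner_diff_right[of "y - z" y z] by simp

lemma cinner_ext_left: "(\<And>x. cinner y x = cinner z x) \<Longrightarrow> (y::'a::complex_hilbert) = z"
  using cinner_diff_left[of y z "y - z"] by simp

lemma cinner_dense_ext:
  assumes S: "closure S = UNIV" and eq: "\<And>x. x \<in> S \<Longrightarrow> cinner x y = cinner x z"
  shows "(y::'a::complex_hilbert) = z"
proof -
  have "closed {x. cinner x (y - z) = 0}"
    by (intro closed_Collect_eq continuous_intros)
  moreover have "S \<subseteq> {x. cinner x (y - z) = 0}"
    using eq by (auto simp: cinner_diff_right)
  ultimately have "cinner x (y - z) = 0" for x
    using closure_minimal[of S "{x. cinner x (y - z) = 0}"] S by auto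
  then show ?thesis
    using cinner_self_eq_0[of "y - z"] by simp
qed

lemma continuous_dense_ext:
  fixes f g :: "'a::topological_space \<Rightarrow> 'b::t2_space"
  assumes "closure S = UNIV" "continuous_on UNIV f" "continuous_on UNIV g"
    and "\<And>x. x \<in> S \<Longrightarrow> f x = g x"
  shows "f = g"
proof -
  have "closed {x. f x = g x}"
    using assms by (intro closed_Collect_eq)
  moreover have "S \<subseteq> {x. f x = g x}"
    using assms by auto
  ultimately show ?thesis
    using closure_minimal[of S "{x. f x = g x}"] assms(1) by auto
qed

subsection \<open>Bounded operators\<close>

lemma bounded_clinearD:
  assumes "bounded_clinear T"
  shows bounded_clinear_imp_linear: "bounded_linear T"
    and bounded_clinear_add: "T (x + y) = T x + T y"
    and bounded_clinear_diff: "T (x - y) = T x - T y"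
    and bounded_clinear_minus: "T (- x) = - T x"
    and bounded_clinear_zero: "T 0 = 0"
    and bounded_clinear_scaleC: "T (c *\<^sub>C x) = c *\<^sub>C T x"
    and bounded_clinear_continuous: "continuous_on S T"
  using assms bounded_linear.linear[of T] linear_continuous_on[of T S]
  by (auto simp: bounded_clinear_def linear_add linear_diff linear_neg linear_0)

lemma bounded_clinear_bound:
  assumes "bounded_clinear T"
  obtains K where "K \<ge> 0" "\<And>x. norm (T x) \<le> K * norm x"
  using bounded_linear.nonneg_bounded[of T] assms
  by (auto simp: bounded_clinear_def mult.commute)

lemma bounded_clinearI:
  assumes "\<And>x y. T (x + y) = T x + T y" "\<And>c x. T (c *\<^sub>C x) = c *\<^sub>C T x"
    and "\<And>x. norm (T x) \<le> K * norm x"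
  shows "bounded_clinear T"
  unfolding bounded_clinear_def
  using assms by (auto intro!: bounded_linear_intro[of _ K] simp: scaleR_scaleC mult.commute)

lemma bounded_clinear_compose:
  assumes "bounded_clinear S" "bounded_clinear T"
  shows "bounded_clinear (\<lambda>x. S (T x))"
  using assms bounded_linear_compose[of S T] by (auto simp: bounded_clinear_def)

lemma bounded_clinear_plus:
  assumes "bounded_clinear S" "bounded_clinear T"
  shows "bounded_clinear (\<lambda>x. S x + T x)"
  using assms bounded_linear_add[of S T] by (auto simp: bounded_clinear_def scaleC_add_right)

lemma bounded_clinear_cmult:
  assumes "bounded_clinear T"
  shows "bounded_clinear (\<lambda>x. c *\<^sub>C T x)"
  using assms bounded_linear_compose[OF bounded_linear_scaleC, of T c]
  by (auto simp: bounded_clinear_def scaleC_scaleC mult.commute)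

lemma bounded_clinear_sub:
  assumes "bounded_clinear S" "bounded_clinear T"
  shows "bounded_clinear (\<lambda>x. S x - T x)"
  using assms bounded_linear_sub[of S T] by (auto simp: bounded_clinear_def scaleC_diff_right)

lemma bounded_clinear_uminus: "bounded_clinear T \<Longrightarrow> bounded_clinear (\<lambda>x. - T x)"
  by (auto simp: bounded_clinear_def intro: bounded_linear_minus)

lemma bounded_clinear_ident: "bounded_clinear (\<lambda>x. x)"
  by (simp add: bounded_clinear_def)

text \<open>Moving \<open>T\<close> to the other slot leaves only the linearity of the inner
  product. Exhibiting a formal adjoint thus proves linearity as well, which is why boundedness
  proofs below consist of a single adjoint identity.\<close>

lemma additive_cinner_adjoint:
  assumes "\<And>x y. cinner (T x) y = cinner x (S y)"
  shows "T (x + y) = T x + T y" "T (c *\<^sub>C x) = c *\<^sub>C T x"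
  by (rule cinner_ext_left, simp add: assms cinner_simps)+

subsection \<open>Orthogonal projection, the Riesz theorem and adjoints\<close>

text \<open>The parallelogram law controls squared distances, hence the square in the hypothesis;
  \<open>e\<close> measures how far a minimizing sequence is from the minimum.\<close>

lemma Cauchy_of_norm_sq_le:
  fixes X :: "nat \<Rightarrow> 'a::real_normed_vector"
  assumes "\<And>m n. (norm (X m - X n))\<^sup>2 \<le> c * (e m + e n)" "e \<longlonglongrightarrow> (0::real)"
    and "c > 0" "\<And>n. e n \<ge> 0"
  shows "Cauchy X"
proof (rule CauchyI)
  fix r :: real assume "r > 0"
  then have "r\<^sup>2 / (2 * c) > 0" using \<open>c > 0\<close> by simp
  then obtain N where N: "\<And>n. n \<ge> N \<Longrightarrow> norm (e n - 0) < r\<^sup>2 / (2 * c)"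
    using LIMSEQ_D[OF assms(2)] by metis
  show "\<exists>N. \<forall>m\<ge>N. \<forall>n\<ge>N. norm (X m - X n) < r"
  proof (intro exI allI impI)
    fix m n assume "N \<le> m" "N \<le> n"
    then have "e m + e n < r\<^sup>2 / (2 * c) + r\<^sup>2 / (2 * c)"
      using N[of m] N[of n] by (intro add_strict_mono) auto
    then have "c * (e m + e n) < r\<^sup>2"
      using \<open>c > 0\<close> by (simp add: field_simps)
    then have "(norm (X m - X n))\<^sup>2 < r\<^sup>2"
      using assms(1)[of m n] by linarith
    then show "norm (X m - X n) < r"
      using \<open>r > 0\<close> by (simp add: power_less_imp_less_base)
  qed
qed

lemma closest_point_in_subspace:
  fixes V :: "'a::complex_hilbert set"
  assumes V: "closed V" "V \<noteq> {}" and add: "\<And>x y. x \<in> V \<Longrightarrow> y \<in> V \<Longrightarrow> x + y \<in> V"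
    and scale: "\<And>c x. x \<in> V \<Longrightarrow> c *\<^sub>C x \<in> V"
  obtains v where "v \<in> V" "\<And>w. w \<in> V \<Longrightarrow> norm (p - v) \<le> norm (p - w)"
proof -
  define d where "d = (INF v\<in>V. (norm (p - v))\<^sup>2)"
  have bdd: "bdd_below ((\<lambda>v. (norm (p - v))\<^sup>2) ` V)"
    by (auto intro: bdd_belowI[of _ 0])
  have d_le: "d \<le> (norm (p - v))\<^sup>2" if "v \<in> V" for v
    unfolding d_def using bdd that by (rule cINF_lower)
  have "\<exists>v\<in>V. (norm (p - v))\<^sup>2 < d + 1 / real (Suc n)" for n
  proof -
    have "Inf ((\<lambda>v. (norm (p - v))\<^sup>2) ` V) < d + 1 / real (Suc n)" unfolding d_def by simp
    then show ?thesis using bdd V(2) by (subst (asm) cInf_less_iff) auto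
  qed
  then obtain X where X: "\<And>n. X n \<in> V" "\<And>n. (norm (p - X n))\<^sup>2 < d + 1 / real (Suc n)"
    by metis
  have le: "(norm (X m - X n))\<^sup>2 \<le> 2 * (1 / real (Suc m) + 1 / real (Suc n))" for m n
  proof -
    \<comment> \<open>The midpoint stays in \<open>V\<close>, so it is no closer to \<open>p\<close>
      than the infimum allows; the parallelogram law turns this into a bound on
      \<open>X m - X n\<close>.\<close>
    have "(1/2) *\<^sub>C (X m + X n) \<in> V" using X add scale by blast
    then have "d \<le> (norm (p - (1/2) *\<^sub>C (X m + X n)))\<^sup>2" by (rule d_le)
    also have "p - (1/2) *\<^sub>C (X m + X n) = (1/2) *\<^sub>C ((p - X m) + (p - X n))"
      using scaleC_add_left[of "1/2" "1/2" p] by (simp add: scaleC_add_right scaleC_diff_right)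
    also have "(norm \<dots>)\<^sup>2 = (norm ((p - X m) + (p - X n)))\<^sup>2 / 4"
      by (simp only: norm_scaleC power_mult_distrib) (simp add: power2_eq_square norm_divide)
    finally have "4 * d \<le> (norm ((p - X m) + (p - X n)))\<^sup>2" by simp
    moreover have "(p - X m) - (p - X n) = X n - X m" by simp
    ultimately show ?thesis
      using parallelogram[of "p - X m" "p - X n"] X(2)[of m] X(2)[of n]
      by (simp add: norm_minus_commute)
  qed
  have "Cauchy X"
    using le LIMSEQ_inverse_real_of_nat
    by (intro Cauchy_of_norm_sq_le[of X 2 "\<lambda>n. 1 / real (Suc n)"]) (auto simp: inverse_eq_divide)
  then obtain v where v: "X \<longlonglongrightarrow> v"
    using Cauchy_convergent convergent_def by blast
  show ?thesis
  proof (rule that)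
    show "v \<in> V" using V(1) X(1) v closed_sequentially by blast
    have "(norm (p - v))\<^sup>2 \<le> d"
    proof (rule LIMSEQ_le)
      show "(\<lambda>n. (norm (p - X n))\<^sup>2) \<longlonglongrightarrow> (norm (p - v))\<^sup>2" by (intro tendsto_intros v)
      show "(\<lambda>n. d + 1 / real (Suc n)) \<longlonglongrightarrow> d"
        using tendsto_add[OF tendsto_const LIMSEQ_inverse_real_of_nat, of d]
        by (simp add: inverse_eq_divide)
      show "\<exists>N. \<forall>n\<ge>N. (norm (p - X n))\<^sup>2 \<le> d + 1 / real (Suc n)"
        using X(2) less_imp_le by blast
    qed
    then show "norm (p - v) \<le> norm (p - w)" if "w \<in> V" for w
      using d_le[OF that] by (meson norm_ge_zero order_trans power2_le_imp_le)
  qed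
qed

lemma orthogonal_projection:
  fixes V :: "'a::complex_hilbert set"
  assumes V: "closed V" "V \<noteq> {}" and add: "\<And>x y. x \<in> V \<Longrightarrow> y \<in> V \<Longrightarrow> x + y \<in> V"
    and scale: "\<And>c x. x \<in> V \<Longrightarrow> c *\<^sub>C x \<in> V"
  obtains v where "v \<in> V" "\<And>w. w \<in> V \<Longrightarrow> cinner w (p - v) = 0"
proof -
  obtain v where v: "v \<in> V" and min: "\<And>w. w \<in> V \<Longrightarrow> norm (p - v) \<le> norm (p - w)"
    using closest_point_in_subspace[OF assms] by metis
  have "cinner w (p - v) = 0" if w: "w \<in> V" for w
  proof (cases "w = 0")
    case False
    \<comment> \<open>Moving \<open>v\<close> by the projection of the error \<open>p - v\<close>
      onto \<open>w\<close> lowers the squared distance by \<open>|(p - v, w)|^2 / |w|^2\<close>,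
      which minimality forces to vanish.\<close>
    define c where "c = cinner (p - v) w / of_real ((norm w)\<^sup>2)"
    have "v + c *\<^sub>C w \<in> V" using v w add scale by blast
    then have "(norm (p - v))\<^sup>2 \<le> (norm ((p - v) - c *\<^sub>C w))\<^sup>2"
      using min[of "v + c *\<^sub>C w"] by (simp add: diff_diff_eq)
    moreover have "cnj c * cinner (p - v) w = of_real ((cmod (cinner (p - v) w))\<^sup>2 / (norm w)\<^sup>2)"
      by (simp add: c_def complex_norm_square mult.commute del: of_real_power)
    moreover have "(norm (c *\<^sub>C w))\<^sup>2 = (cmod (cinner (p - v) w))\<^sup>2 / (norm w)\<^sup>2"
      using False unfolding c_def by (rule norm_coeff_scaleC)
    ultimately have "(cmod (cinner (p - v) w))\<^sup>2 / (norm w)\<^sup>2 \<le> 0"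
      unfolding norm_diff_sq[of "p - v"] cinner_scaleC_right by simp
    then have "cinner (p - v) w = 0"
      using False by (simp add: divide_le_0_iff)
    then show ?thesis
      using cinner_commute[of w "p - v"] by simp
  qed simp
  with v that show ?thesis by blast
qed

lemma riesz_representation:
  assumes \<phi>: "bounded_clinear \<phi>"
  obtains y where "\<And>x::'a::complex_hilbert. \<phi> x = cinner x y"
proof (cases "\<forall>x. \<phi> x = 0")
  case True
  then show ?thesis using that[of 0] by simp
next
  case False
  then obtain p where p: "\<phi> p \<noteq> 0" by blast
  have "closed {x. \<phi> x = 0}"
    by (intro closed_Collect_eq bounded_clinear_continuous[OF \<phi>] continuous_intros)
  then obtain v where v: "\<phi> v = 0" and orth: "\<And>w. \<phi> w = 0 \<Longrightarrow> cinner w (p - v) = 0"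
    by (rule orthogonal_projection[of "{x. \<phi> x = 0}" p])
      (auto simp: bounded_clinear_add[OF \<phi>] bounded_clinear_scaleC[OF \<phi>]
        intro: exI[of _ 0] bounded_clinear_zero[OF \<phi>])
  define e where "e = p - v"
  have e: "\<phi> e = \<phi> p" using v by (simp add: e_def bounded_clinearD[OF \<phi>])
  then have "e \<noteq> 0" using p by (auto simp: bounded_clinearD[OF \<phi>])
  show ?thesis
  proof (rule that)
    fix x
    \<comment> \<open>The kernel of \<open>\<phi>\<close> has codimension one: subtracting the right
      multiple of \<open>e\<close> from \<open>x\<close> lands in it, and \<open>e\<close> is
      orthogonal to it.\<close>
    have "cinner (x - (\<phi> x / \<phi> e) *\<^sub>C e) e = 0"
      using orth[of "x - (\<phi> x / \<phi> e) *\<^sub>C e"] p e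
      by (simp add: bounded_clinearD[OF \<phi>] scaleC_complex_def e_def[symmetric])
    then have "cinner x e = (\<phi> x / \<phi> e) * cinner e e" by (simp add: cinner_simps)
    then show "\<phi> x = cinner x (cnj (\<phi> e / cinner e e) *\<^sub>C e)"
      using \<open>e \<noteq> 0\<close> p e by (simp add: cinner_scaleC_right)
  qed
qed

lemma cadjoint_unique:
  assumes "\<And>x y. cinner (T x) y = cinner x (S y)"
  shows "cadjoint T = S"
  unfolding cadjoint_def
proof (rule the_equality)
  show "S' = S" if "\<forall>x y. cinner (T x) y = cinner x (S' y)" for S'
    by (rule ext, rule cinner_ext_right) (metis that assms)
qed (use assms in blast)

lemma adjoint_exists:
  fixes T :: "'a::complex_hilbert \<Rightarrow> 'b::complex_hilbert"
  assumes T: "bounded_clinear T"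
  obtains S where "\<And>x y. cinner (T x) y = cinner x (S y)"
proof -
  have "\<exists>s. \<forall>x. cinner (T x) y = cinner x s" for y
  proof -
    obtain K where K: "K \<ge> 0" "\<And>x. norm (T x) \<le> K * norm x"
      using bounded_clinear_bound[OF T] by metis
    have "bounded_clinear (\<lambda>x. cinner (T x) y)"
    proof (rule bounded_clinearI[of _ "K * norm y"])
      show "norm (cinner (T x) y) \<le> K * norm y * norm x" for x
        using order_trans[OF cinner_norm_le mult_right_mono[OF K(2)]]
        by (metis mult.commute mult.left_commute norm_ge_zero)
    qed (simp_all add: bounded_clinearD[OF T] cinner_simps scaleC_complex_def)
    then show ?thesis using riesz_representation by metis
  qed
  then show ?thesis using that by metis
qed

lemma cinner_cadjoint:
  assumes "bounded_clinear T"
  shows "cinner (T x) y = cinner x (cadjoint T y)"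
  using adjoint_exists[OF assms] cadjoint_unique[of T] by metis

subsection \<open>The Hellinger-Toeplitz theorem\<close>

lemma Baire_closed_cover:
  fixes F :: "nat \<Rightarrow> 'a::complete_space set"
  assumes "\<And>n. closed (F n)" "(\<Union>n. F n) = UNIV"
  obtains n where "interior (F n) \<noteq> {}"
proof (rule ccontr)
  assume "\<not> thesis"
  with that have "interior (F n) = {}" for n by blast
  then have "euclidean interior_of \<Union>(range F) = {}"
    using assms(1) by (intro Baire_category_alt) (auto simp: completely_metrizable_space_euclidean)
  then show False using assms(2) by simp
qed

text \<open>The images of the unit ball are weakly bounded, hence bounded by Baire's theorem.\<close>

lemma hellinger_toeplitz:
  fixes P :: "'a::complex_hilbert \<Rightarrow> 'b::complex_hilbert"
  assumes adj: "\<And>x y. cinner (P x) y = cinner x (P' y)"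
  shows "bounded_clinear P"
proof -
  define F where "F n = {y. \<forall>x\<in>cball 0 1. cmod (cinner (P x) y) \<le> real n}" for n
  have "closed (F n)" for n
  proof -
    have "F n = (\<Inter>x\<in>cball 0 1. {y. cmod (cinner (P x) y) \<le> real n})" by (auto simp: F_def)
    then show ?thesis by (auto intro!: closed_INT closed_Collect_le continuous_intros)
  qed
  moreover have "y \<in> (\<Union>n. F n)" for y
  proof -
    obtain n where n: "norm (P' y) \<le> real n" using real_arch_simple by blast
    have "cmod (cinner (P x) y) \<le> real n" if "x \<in> cball 0 1" for x
    proof -
      have "cmod (cinner (P x) y) \<le> norm x * norm (P' y)" by (simp add: adj cinner_norm_le)
      also have "\<dots> \<le> 1 * norm (P' y)" using that by (intro mult_right_mono) auto
      finally show ?thesis using n by simp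
    qed
    then show ?thesis unfolding F_def by blast
  qed
  ultimately obtain n where "interior (F n) \<noteq> {}"
    using Baire_closed_cover[of F] by blast
  then obtain y0 r where r: "r > 0" "cball y0 r \<subseteq> F n"
    using mem_interior_cball by (metis ex_in_conv)
  have bound: "norm (P x) \<le> 2 * real n / r" if x: "norm x \<le> 1" for x
  proof (cases "P x = 0")
    case False
    \<comment> \<open>The test vector points along \<open>P x\<close> and has length
      \<open>r\<close>. The ball is centred at \<open>y0\<close> and not at zero, so the value at
      \<open>y0\<close> is subtracted, at the price of a factor 2.\<close>
    define y where "y = (of_real (r / norm (P x))) *\<^sub>C P x"
    have "norm y = r" using False r by (simp add: y_def norm_divide)
    then have "y0 + y \<in> F n" "y0 \<in> F n" using r by (auto simp: dist_norm)
    then have "cmod (cinner (P x) (y0 + y)) \<le> real n" "cmod (cinner (P x) y0) \<le> real n"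
      using x by (auto simp: F_def)
    then have "cmod (cinner (P x) (y0 + y) - cinner (P x) y0) \<le> real n + real n"
      using norm_triangle_ineq4[of "cinner (P x) (y0 + y)" "cinner (P x) y0"] by linarith
    moreover have "cinner (P x) (y0 + y) - cinner (P x) y0 = of_real (r * norm (P x))"
      using False by (simp add: y_def cinner_simps cinner_self power2_eq_square)
    ultimately show ?thesis using r by (simp add: norm_mult field_simps)
  qed (use r in simp)
  note lin = additive_cinner_adjoint[of P P', OF adj]
  show ?thesis
  proof (rule bounded_clinearI[of _ "2 * real n / r"])
    show "norm (P x) \<le> 2 * real n / r * norm x" for x
    proof (cases "x = 0")
      case True
      then show ?thesis using lin(2)[of 0 0] by simp
    next
      case False
      have "norm (P ((of_real (1 / norm x)) *\<^sub>C x)) \<le> 2 * real n / r"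
        using False by (intro bound) (simp add: norm_divide)
      then show ?thesis using False by (simp only: lin norm_scaleC) (simp add: field_simps norm_divide)
    qed
  qed (use lin in auto)
qed

lemma bounded_clinear_cadjoint: "bounded_clinear T \<Longrightarrow> bounded_clinear (cadjoint T)"
  by (rule hellinger_toeplitz[of _ T]) (metis cinner_cadjoint cinner_commute)

lemma cinner_cadjoint_left:
  "bounded_clinear T \<Longrightarrow> cinner (cadjoint T x) y = cinner x (T y)"
  by (metis cinner_cadjoint cinner_commute)

subsection \<open>The second adjoint\<close>

text \<open>Turns the graph of a closed operator into a closed subspace of a Hilbert space, to which
  the projection theorem applies.\<close>

instantiation prod :: (complex_hilbert, complex_hilbert) complex_hilbert
begin

definition scaleC_prod :: "complex \<Rightarrow> 'a \<times> 'b \<Rightarrow> 'a \<times> 'b" where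
  "scaleC_prod c p = (c *\<^sub>C fst p, c *\<^sub>C snd p)"

definition cinner_prod :: "'a \<times> 'b \<Rightarrow> 'a \<times> 'b \<Rightarrow> complex" where
  "cinner_prod p q = cinner (fst p) (fst q) + cinner (snd p) (snd q)"

instance
proof
  show "cinner p p = complex_of_real ((norm p)\<^sup>2)" for p :: "'a \<times> 'b"
    by (simp add: cinner_prod_def norm_prod_def cinner_self)
  show "cinner p q = cnj (cinner q p)" for p q :: "'a \<times> 'b"
    by (simp add: cinner_prod_def cinner_commute[of "fst q"] cinner_commute[of "snd q"])
qed (auto simp: scaleC_prod_def cinner_prod_def scaleR_prod_def scaleC_add_right scaleC_add_left
    scaleC_scaleC scaleR_scaleC cinner_simps algebra_simps)

end

lemma op_adjoint_op_adjoint: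
  assumes lin: "linear_operator A" and "closed A"
  shows "op_adjoint (op_adjoint A) = A"
proof
  show "A \<subseteq> op_adjoint (op_adjoint A)"
  proof safe
    fix f f' assume f: "(f, f') \<in> A"
    have "cinner g' f = cinner g f'" if "(g, g') \<in> op_adjoint A" for g g'
    proof -
      have "cinner f' g = cinner f g'" using that f by (auto simp: op_adjoint_def)
      then show ?thesis by (metis cinner_commute)
    qed
    then show "(f, f') \<in> op_adjoint (op_adjoint A)" by (auto simp: op_adjoint_def)
  qed
  show "op_adjoint (op_adjoint A) \<subseteq> A"
  proof safe
    fix f f' assume f: "(f, f') \<in> op_adjoint (op_adjoint A)"
    obtain v where v: "v \<in> A" and orth: "\<And>w. w \<in> A \<Longrightarrow> cinner w ((f, f') - v) = 0"
    proof (rule orthogonal_projection[of A "(f, f')"])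
      show "x + y \<in> A" "c *\<^sub>C x \<in> A" if "x \<in> A" "y \<in> A" for x y c
        using lin that by (fastforce simp: linear_operator_def scaleC_prod_def)+
      show "A \<noteq> {}" using lin by (auto simp: linear_operator_def)
    qed (use \<open>closed A\<close> in auto)
    define h h' where "h = f - fst v" and "h' = f' - snd v"
    \<comment> \<open>The residual of the projection onto the graph is orthogonal to the graph, and
      rotating it gives an element of the adjoint. Pairing this element with both
      \<open>(f, f')\<close> and \<open>v\<close> makes the residual orthogonal to itself.\<close>
    have "(h', - h) \<in> op_adjoint A"
    proof -
      have "cinner g' h' = cinner g (- h)" if "(g, g') \<in> A" for g g'
        using orth[OF that] by (simp add: cinner_prod_def eq_neg_iff_add_eq_0 add.commute
            flip: h_def h'_def)
      then show ?thesis by (auto simp: op_adjoint_def)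
    qed
    then have "cinner (- h) f = cinner h' f'"
      using f unfolding op_adjoint_def[of "op_adjoint A"] by blast
    moreover have "cinner (- h) (fst v) = cinner h' (snd v)"
    proof -
      have "cinner (snd v) h' = cinner (fst v) (- h)"
        using \<open>(h', - h) \<in> op_adjoint A\<close> v by (cases v) (auto simp: op_adjoint_def)
      then show ?thesis by (metis cinner_commute)
    qed
    ultimately have "cinner (- h) h = cinner h' h'"
      by (simp add: h_def h'_def cinner_diff_right)
    then have "cinner h h + cinner h' h' = 0"
      by (metis cinner_minus_left add.right_inverse)
    then have "of_real ((norm h)\<^sup>2 + (norm h')\<^sup>2) = (0::complex)"
      by (simp add: cinner_self)
    then have "h = 0" "h' = 0"
      by (auto simp only: of_real_eq_0_iff sum_power2_eq_zero_iff norm_eq_zero)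
    then show "(f, f') \<in> A"
      using v by (cases v) (simp add: h_def h'_def)
  qed
qed

subsection \<open>Extension from a dense subspace\<close>

lemma clinear_onD:
  assumes "clinear_on V T"
  shows clinear_on_add: "x \<in> V \<Longrightarrow> y \<in> V \<Longrightarrow> T (x + y) = T x + T y"
    and clinear_on_scaleC: "x \<in> V \<Longrightarrow> T (c *\<^sub>C x) = c *\<^sub>C T x"
  using assms by (auto simp: clinear_on_def)

lemma clinear_on_diff:
  assumes "clinear_on V T" "x \<in> V" "y \<in> V" "- y \<in> V"
  shows "T (x - y) = T x - T y"
  using clinear_on_add[OF assms(1,2,4)] clinear_on_scaleC[OF assms(1,3), of "-1"] by simp

text \<open>The bound makes \<open>T\<close> a Lipschitz function of \<open>\<iota> h\<close>, so it
  extends by uniform continuity; linearity and the bound follow by density, one argument at a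
  time.\<close>

lemma bounded_clinear_extension:
  fixes \<iota> :: "'h::complex_hilbert \<Rightarrow> 'e::complex_hilbert" and T :: "'h \<Rightarrow> 'k::complex_hilbert"
  assumes \<iota>: "clinear_on UNIV \<iota>" and dense: "closure (range \<iota>) = UNIV"
    and T: "clinear_on UNIV T" and bound: "\<And>h. norm (T h) \<le> K * norm (\<iota> h)"
  obtains F where "bounded_clinear F" "\<And>h. F (\<iota> h) = T h"
proof -
  \<comment> \<open>The choice of preimage is harmless: two preimages differ by a vector of zero
    image, which \<open>T\<close> kills by the bound.\<close>
  define F\<^sub>0 where "F\<^sub>0 y = T (SOME h. \<iota> h = y)" for y
  have diff: "\<iota> (x - y) = \<iota> x - \<iota> y" "T (x - y) = T x - T y" for x y
    using clinear_on_diff[OF \<iota>] clinear_on_diff[OF T] by auto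
  have F\<^sub>0: "F\<^sub>0 (\<iota> h) = T h" for h
  proof -
    have "\<iota> (SOME k. \<iota> k = \<iota> h) = \<iota> h" by (rule someI) simp
    then have "norm (T ((SOME k. \<iota> k = \<iota> h) - h)) \<le> 0"
      using bound[of "(SOME k. \<iota> k = \<iota> h) - h"] by (simp add: diff)
    then show ?thesis by (simp add: F\<^sub>0_def diff)
  qed
  have "uniformly_continuous_on (range \<iota>) F\<^sub>0"
  proof (rule lipschitz_on_uniformly_continuous)
    \<comment> \<open>A Lipschitz constant must be nonnegative, whereas \<open>K\<close> is an
      arbitrary real number.\<close>
    show "\<bar>K\<bar>-lipschitz_on (range \<iota>) F\<^sub>0"
    proof (rule lipschitz_onI)
      fix x y assume "x \<in> range \<iota>" "y \<in> range \<iota>"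
      then obtain h k where [simp]: "x = \<iota> h" "y = \<iota> k" by blast
      have "norm (T (h - k)) \<le> \<bar>K\<bar> * norm (\<iota> (h - k))"
        using bound[of "h - k"] mult_right_mono[OF abs_ge_self[of K] norm_ge_zero[of "\<iota> (h - k)"]]
        by linarith
      then show "dist (F\<^sub>0 x) (F\<^sub>0 y) \<le> \<bar>K\<bar> * dist x y"
        by (simp add: F\<^sub>0 dist_norm diff)
    qed simp
  qed
  then obtain F where "uniformly_continuous_on (closure (range \<iota>)) F"
    and F: "\<And>y. y \<in> range \<iota> \<Longrightarrow> F\<^sub>0 y = F y"
    using uniformly_continuous_on_extension_on_closure by metis
  then have cont: "continuous_on UNIV F"
    using dense uniformly_continuous_imp_continuous by metis
  then have cont': "continuous_on UNIV (\<lambda>x. F (g x))" if "continuous_on UNIV g" for g :: "'e \<Rightarrow> 'e"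
    using that continuous_on_compose2[of UNIV F UNIV g] by simp
  have F\<iota>: "F (\<iota> h) = T h" for h
    using F[of "\<iota> h"] F\<^sub>0[of h] by simp
  have add1: "F (x + \<iota> k) = F x + F (\<iota> k)" for x k
  proof -
    have "(\<lambda>x. F (x + \<iota> k)) = (\<lambda>x. F x + F (\<iota> k))"
    proof (rule continuous_dense_ext[OF dense])
      show "F (x + \<iota> k) = F x + F (\<iota> k)" if "x \<in> range \<iota>" for x
        using that by (auto simp: F\<iota> clinear_on_add[OF T] simp flip: clinear_on_add[OF \<iota>])
    qed (intro cont cont' continuous_intros)+
    then show ?thesis by metis
  qed
  have add: "F (x + y) = F x + F y" for x y
  proof -
    have "(\<lambda>y. F (x + y)) = (\<lambda>y. F x + F y)"
    proof (rule continuous_dense_ext[OF dense])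
    qed (auto intro!: cont cont' continuous_intros simp: add1)
    then show ?thesis by metis
  qed
  have scale: "F (c *\<^sub>C x) = c *\<^sub>C F x" for c x
  proof -
    have "(\<lambda>x. F (c *\<^sub>C x)) = (\<lambda>x. c *\<^sub>C F x)"
    proof (rule continuous_dense_ext[OF dense])
      show "F (c *\<^sub>C x) = c *\<^sub>C F x" if "x \<in> range \<iota>" for x
        using that by (auto simp: F\<iota> clinear_on_scaleC[OF T] simp flip: clinear_on_scaleC[OF \<iota>])
    qed (intro cont cont' continuous_intros)+
    then show ?thesis by metis
  qed
  have "closed {x. norm (F x) \<le> K * norm x}"
    by (intro closed_Collect_le cont continuous_intros)
  moreover have "range \<iota> \<subseteq> {x. norm (F x) \<le> K * norm x}"
    using bound by (auto simp: F\<iota>)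
  ultimately have "norm (F x) \<le> K * norm x" for x
    using closure_minimal[of "range \<iota>" "{x. norm (F x) \<le> K * norm x}"] dense by auto
  then have "bounded_clinear F"
    by (intro bounded_clinearI[of F K] add scale)
  then show ?thesis using that F\<iota> by blast
qed

lemma extend_by_continuity_eq:
  assumes "closure (range \<iota>) = UNIV" "continuous_on UNIV F" "\<And>h. F (\<iota> h) = \<iota> (T h)"
  shows "extend_by_continuity \<iota> T = F"
  unfolding extend_by_continuity_def
proof (rule the_equality)
  show "G = F" if "continuous_on UNIV G \<and> (\<forall>h. G (\<iota> h) = \<iota> (T h))" for G
    using that assms by (intro continuous_dense_ext[of "range \<iota>" G F]) auto
qed (use assms in blast)

lemma dense_subspace:
  fixes V :: "'a::complex_hilbert set"
  assumes "V \<noteq> {}" and add: "\<And>x y. x \<in> V \<Longrightarrow> y \<in> V \<Longrightarrow> x + y \<in> V"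
    and scale: "\<And>c x. x \<in> V \<Longrightarrow> c *\<^sub>C x \<in> V"
    and orth: "\<And>y. (\<And>x. x \<in> V \<Longrightarrow> cinner x y = 0) \<Longrightarrow> y = 0"
  shows "closure V = UNIV"
proof -
  have "p \<in> closure V" for p
  proof -
    obtain v where v: "v \<in> closure V" and o: "\<And>w. w \<in> closure V \<Longrightarrow> cinner w (p - v) = 0"
    proof (rule orthogonal_projection[of "closure V" p])
      fix x y c assume xy: "x \<in> closure V" "y \<in> closure V"
      then obtain X Y where X: "\<And>n. X n \<in> V" "X \<longlonglongrightarrow> x" and Y: "\<And>n. Y n \<in> V" "Y \<longlonglongrightarrow> y"
        unfolding closure_sequential by blast
      have "(\<lambda>n. X n + Y n) \<longlonglongrightarrow> x + y" "(\<lambda>n. c *\<^sub>C X n) \<longlonglongrightarrow> c *\<^sub>C x"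
        by (intro tendsto_intros X Y)+
      moreover have "X n + Y n \<in> V" "c *\<^sub>C X n \<in> V" for n
        using add scale X Y by auto
      ultimately show "x + y \<in> closure V" "c *\<^sub>C x \<in> closure V"
        unfolding closure_sequential by (intro exI conjI; blast)+
    qed (use \<open>V \<noteq> {}\<close> in auto)
    have "p - v = 0" using o closure_subset by (intro orth) blast
    then show ?thesis using v by simp
  qed
  then show ?thesis by blast
qed

lemma dense_range_of_injective_symmetric:
  fixes N :: "'h::complex_hilbert \<Rightarrow> 'h"
  assumes sym: "\<And>x y. cinner (N x) y = cinner x (N y)" and inj: "\<And>x. N x = 0 \<Longrightarrow> x = 0"
  shows "closure (range N) = UNIV"
proof (rule dense_subspace)
  note lin = additive_cinner_adjoint[of N N, OF sym]
  fix x y c assume "x \<in> range N" "y \<in> range N"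
  then obtain a b where "x = N a" "y = N b" by blast
  then have "x + y = N (a + b)" "c *\<^sub>C x = N (c *\<^sub>C a)"
    using lin(1)[of a b] lin(2)[of c a] by simp_all
  then show "x + y \<in> range N" "c *\<^sub>C x \<in> range N" by auto
next
  show "y = 0" if "\<And>x. x \<in> range N \<Longrightarrow> cinner x y = 0" for y
  proof (rule inj)
    \<comment> \<open>Testing against \<open>N (N y)\<close> produces the squared norm of
      \<open>N y\<close>: the orthogonal complement of the range is the kernel.\<close>
    have "cinner (N (N y)) y = 0" using that by blast
    then show "N y = 0" unfolding sym[of "N y" y] by simp
  qed
qed auto

section \<open>Square roots and polar decomposition\<close>

text \<open>Polarization: the quadratic form is real at \<open>x + y\<close> and at
  \<open>x + \<i> *\<^sub>C y\<close>, which fixes the imaginary and the real part of the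
  sesquilinear form.\<close>

lemma positive_op_symmetric:
  assumes P: "positive_op P"
  shows "cinner (P x) y = cinner x (P y)"
proof -
  have bP: "bounded_clinear P" and real: "Im (cinner (P x) x) = 0" for x
    using P by (auto simp: positive_op_def complex_nonneg_Reals_iff)
  note lin = bounded_clinear_add[OF bP] bounded_clinear_scaleC[OF bP]
  have "Im (cinner (P x) y) = - Im (cinner (P y) x)"
    using real[of "x + y"] real[of x] real[of y] by (simp add: lin cinner_simps)
  moreover have "Re (cinner (P x) y) = Re (cinner (P y) x)"
    using real[of "x + \<i> *\<^sub>C y"] real[of x] real[of y] by (simp add: lin cinner_simps)
  ultimately have "cinner (P x) y = cnj (cinner (P y) x)"
    by (simp add: complex_eq_iff)
  then show ?thesis by (metis cinner_commute)
qed

text \<open>Positivity of the form at \<open>y = x - P x / K\<close>, a gradient step, gives the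
  estimate after rearrangement. It avoids the square root of \<open>P\<close>, whose construction
  relies on it.\<close>

lemma positive_op_norm_sq_le:
  assumes P: "positive_op P" and K: "\<And>x. norm (P x) \<le> K * norm x" "K > 0"
  shows "(norm (P x))\<^sup>2 \<le> K * Re (cinner (P x) x)"
proof -
  have bP: "bounded_clinear P" and pos: "0 \<le> Re (cinner (P x) x)" for x
    using P by (auto simp: positive_op_def complex_nonneg_Reals_iff)
  have "Re (cinner (P (P x)) (P x)) \<le> norm (P (P x)) * norm (P x)"
    using complex_Re_le_cmod cinner_norm_le order_trans by blast
  also have "\<dots> \<le> K * norm (P x) * norm (P x)"
    by (intro mult_right_mono K) auto
  finally have PP: "Re (cinner (P (P x)) (P x)) \<le> K * (norm (P x))\<^sup>2"
    by (simp add: power2_eq_square)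
  define y where "y = x - of_real (1 / K) *\<^sub>C P x"
  have sym: "Re (cinner (P (P x)) x) = (norm (P x))\<^sup>2" "Re (cinner (P x) (P x)) = (norm (P x))\<^sup>2"
    by (simp_all only: positive_op_symmetric[OF P, of "P x"] norm_sq_cinner)
  have "Re (cinner (P y) y) = Re (cinner (P x) x) - 2 / K * (norm (P x))\<^sup>2
      + Re (cinner (P (P x)) (P x)) / K\<^sup>2"
    unfolding y_def bounded_clinear_diff[OF bP] bounded_clinear_scaleC[OF bP]
    using K(2) by (simp add: cinner_simps sym) (simp add: field_simps power2_eq_square)
  also have "\<dots> \<le> Re (cinner (P x) x) - 2 / K * (norm (P x))\<^sup>2 + (K * (norm (P x))\<^sup>2) / K\<^sup>2"
    using PP by (intro add_left_mono divide_right_mono) auto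
  also have "\<dots> = Re (cinner (P x) x) - (norm (P x))\<^sup>2 / K"
    using K(2) by (simp add: power2_eq_square field_simps)
  finally show ?thesis
    using mult_nonneg_nonneg[OF less_imp_le[OF K(2)] pos[of y]] K(2) by (simp add: field_simps)
qed

lemma positive_op_eq_0:
  assumes P: "positive_op P" and x: "cinner (P x) x = 0"
  shows "P x = 0"
proof -
  obtain K where K: "K \<ge> 0" "\<And>x. norm (P x) \<le> K * norm x"
    using bounded_clinear_bound P positive_op_def by metis
  \<comment> \<open>The bound \<open>K\<close> may be zero, and the inequality requires a positive
    constant.\<close>
  have "norm (P x) \<le> (K + 1) * norm x" for x
    using K(2)[of x] norm_ge_zero[of x] unfolding distrib_right by linarith
  from positive_op_norm_sq_le[OF P this, of x] show ?thesis
    using K x by simp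
qed

text \<open>With \<open>Q = 1 - P\<close>, the limit \<open>Y\<close> of this iteration satisfies \<open>(1 - Y)\<^sup>2 = P\<close>. The
  iteration converges in norm because its increments are dominated by those of its scalar
  counterpart \<open>sqrt_majorant\<close>.\<close>

primrec sqrt_iter :: "('a::real_normed_vector \<Rightarrow>\<^sub>L 'a) \<Rightarrow> nat \<Rightarrow> 'a \<Rightarrow>\<^sub>L 'a" where
  "sqrt_iter Q 0 = 0"
| "sqrt_iter Q (Suc n) = (1/2) *\<^sub>R (Q + (sqrt_iter Q n o\<^sub>L sqrt_iter Q n))"

primrec sqrt_majorant :: "nat \<Rightarrow> real" where
  "sqrt_majorant 0 = 0"
| "sqrt_majorant (Suc n) = (1 + (sqrt_majorant n)\<^sup>2) / 2"

lemma sqrt_majorant_bounds: "0 \<le> sqrt_majorant n \<and> sqrt_majorant n \<le> 1"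
proof (induction n)
  case (Suc n)
  then have "(sqrt_majorant n)\<^sup>2 \<le> 1\<^sup>2" by (intro power_mono) auto
  then show ?case by simp
qed simp

lemma incseq_sqrt_majorant: "incseq sqrt_majorant"
proof (rule incseq_SucI)
  fix n
  have "0 \<le> (1 - sqrt_majorant n)\<^sup>2" by simp
  then show "sqrt_majorant n \<le> sqrt_majorant (Suc n)"
    by (simp add: power2_diff)
qed

lemma convergent_sqrt_majorant: "convergent sqrt_majorant"
  using incseq_convergent[OF incseq_sqrt_majorant] sqrt_majorant_bounds convergent_def by metis

lemma norm_sqrt_iter:
  assumes "norm Q \<le> 1"
  shows "norm (sqrt_iter Q n) \<le> sqrt_majorant n"
proof (induction n)
  case (Suc n)
  have "norm (sqrt_iter Q n o\<^sub>L sqrt_iter Q n) \<le> norm (sqrt_iter Q n) * norm (sqrt_iter Q n)"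
    by (rule norm_blinfun_compose)
  also have "\<dots> \<le> sqrt_majorant n * sqrt_majorant n"
    using Suc sqrt_majorant_bounds by (intro mult_mono) auto
  finally have "norm (Q + (sqrt_iter Q n o\<^sub>L sqrt_iter Q n)) \<le> 1 + sqrt_majorant n * sqrt_majorant n"
    using assms norm_triangle_ineq[of Q "sqrt_iter Q n o\<^sub>L sqrt_iter Q n"] by linarith
  then show ?case by (simp add: power2_eq_square)
qed simp

text \<open>The splitting \<open>YY - XX = Y(Y - X) + (Y - X)X\<close> holds without commutativity,
  and its scalar counterpart is the factorization of \<open>y^2 - x^2\<close>; the induction
  compares the two term by term.\<close>

lemma norm_sqrt_iter_Suc_diff:
  assumes Q: "norm Q \<le> 1"
  shows "norm (sqrt_iter Q (Suc n) - sqrt_iter Q n) \<le> sqrt_majorant (Suc n) - sqrt_majorant n"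
proof (induction n)
  case 0
  then show ?case using Q by simp
next
  case (Suc n)
  define X Y x y where "X = sqrt_iter Q n" and "Y = sqrt_iter Q (Suc n)"
    and "x = sqrt_majorant n" and "y = sqrt_majorant (Suc n)"
  have le: "norm X \<le> x" "norm Y \<le> y" "norm (Y - X) \<le> y - x"
    using Suc norm_sqrt_iter[OF Q] by (auto simp: X_def Y_def x_def y_def simp del: sqrt_iter.simps sqrt_majorant.simps)
  then have nonneg: "0 \<le> x" "0 \<le> y" "0 \<le> y - x"
    by (meson norm_ge_zero order_trans)+
  have "sqrt_iter Q (Suc (Suc n)) - sqrt_iter Q (Suc n)
      = (1/2) *\<^sub>R (Q + (Y o\<^sub>L Y)) - (1/2) *\<^sub>R (Q + (X o\<^sub>L X))"
    by (simp add: X_def Y_def)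
  also have "\<dots> = (1/2) *\<^sub>R ((Y o\<^sub>L (Y - X)) + ((Y - X) o\<^sub>L X))"
    by (rule blinfun_eqI) (simp add: blinfun.bilinear_simps algebra_simps)
  also have "norm \<dots> \<le> (1/2) * (norm Y * norm (Y - X) + norm (Y - X) * norm X)"
    using norm_triangle_ineq[of "Y o\<^sub>L (Y - X)" "(Y - X) o\<^sub>L X"]
      norm_blinfun_compose[of Y "Y - X"] norm_blinfun_compose[of "Y - X" X] by simp
  also have "\<dots> \<le> (1/2) * (y * (y - x) + (y - x) * x)"
    using le nonneg by (intro mult_left_mono add_mono mult_mono) auto
  also have "\<dots> = (1 + y\<^sup>2) / 2 - (1 + x\<^sup>2) / 2"
    by (simp add: power2_eq_square algebra_simps diff_divide_distrib)
  also have "\<dots> = sqrt_majorant (Suc (Suc n)) - sqrt_majorant (Suc n)"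
    by (simp add: x_def y_def)
  finally show ?case .
qed

lemma Cauchy_of_dominated_increments:
  fixes X :: "nat \<Rightarrow> 'a::real_normed_vector" and y :: "nat \<Rightarrow> real"
  assumes inc: "\<And>n. norm (X (Suc n) - X n) \<le> y (Suc n) - y n" and "convergent y"
  shows "Cauchy X"
proof -
  have le: "norm (X (n + k) - X n) \<le> y (n + k) - y n" for n k
  proof (induction k)
    case (Suc k)
    then show ?case
      using inc[of "n + k"] norm_triangle_ineq[of "X (Suc (n + k)) - X (n + k)" "X (n + k) - X n"]
      by simp
  qed simp
  have le': "norm (X m - X n) \<le> norm (y m - y n)" for m n
  proof (cases "n \<le> m")
    case True
    then show ?thesis using le[of n "m - n"] by simp
  next
    case False
    then show ?thesis using le[of m "n - m"] by (simp add: norm_minus_commute)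
  qed
  have "Cauchy y" using assms(2) by (rule convergent_Cauchy)
  then show ?thesis
    unfolding Cauchy_iff using le' le_less_trans by meson
qed

lemma convergent_sqrt_iter:
  fixes Q :: "'a::banach \<Rightarrow>\<^sub>L 'a"
  assumes "norm Q \<le> 1"
  obtains Y where "sqrt_iter Q \<longlonglongrightarrow> Y" "norm Y \<le> 1" "2 *\<^sub>R Y = Q + (Y o\<^sub>L Y)"
proof -
  obtain Y where Y: "sqrt_iter Q \<longlonglongrightarrow> Y"
    using Cauchy_of_dominated_increments[OF norm_sqrt_iter_Suc_diff[OF assms] convergent_sqrt_majorant]
    Cauchy_convergent convergent_def by blast
  have "norm Y \<le> 1"
    using norm_sqrt_iter[OF assms] sqrt_majorant_bounds order_trans
    by (intro LIMSEQ_le_const2[OF tendsto_norm[OF Y]]) blast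
  moreover have "(\<lambda>n. sqrt_iter Q (Suc n)) \<longlonglongrightarrow> (1/2) *\<^sub>R (Q + (Y o\<^sub>L Y))"
    unfolding sqrt_iter.simps
    by (intro tendsto_intros Y bounded_bilinear.tendsto[OF bounded_bilinear_blinfun_compose])
  then have "Y = (1/2) *\<^sub>R (Q + (Y o\<^sub>L Y))"
    using LIMSEQ_unique LIMSEQ_Suc[OF Y] by blast
  then have "2 *\<^sub>R Y = Q + (Y o\<^sub>L Y)"
    by (metis pth_1 scaleR_scaleR times_divide_eq_right mult.right_neutral divide_self zero_neq_numeral)
  ultimately show ?thesis using that Y by blast
qed

text \<open>The iterates are polynomials in \<open>1 - P\<close>, so symmetry and commutation with
  every \<open>C\<close> commuting with \<open>P\<close> hold for each of them and survive the
  limit. The commutation clause later gives uniqueness of the root and lets \<open>T\<close> commute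
  with \<open>abs_op T\<close>.\<close>

lemma positive_contraction_sqrt:
  fixes P :: "'h::complex_hilbert \<Rightarrow> 'h"
  assumes P: "positive_op P" and contr: "\<And>x. norm (P x) \<le> norm x"
  obtains S where "positive_op S" "S \<circ> S = P"
    "\<And>C. bounded_clinear C \<Longrightarrow> C \<circ> P = P \<circ> C \<Longrightarrow> C \<circ> S = S \<circ> C"
proof -
  have bP: "bounded_clinear P" using P by (simp add: positive_op_def)
  have bQ: "bounded_clinear (\<lambda>x. x - P x)"
    by (intro bounded_clinear_sub bounded_clinear_ident bP)
  define Q where "Q = Blinfun (\<lambda>x. x - P x)"
  have Q: "blinfun_apply Q x = x - P x" for x
    unfolding Q_def using bQ by (simp add: bounded_linear_Blinfun_apply bounded_clinear_imp_linear)
  have "norm Q \<le> 1"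
  proof (rule norm_blinfun_bound)
    fix x
    \<comment> \<open>Expanding the square of \<open>x - P x\<close> leaves the excess
      \<open>|P x|^2 - 2 Re (P x, x)\<close> over \<open>|x|^2\<close>; this is at most zero as soon
      as \<open>|P x|^2\<close> is bounded by the form.\<close>
    have "(norm (P x))\<^sup>2 \<le> 1 * Re (cinner (P x) x)"
      using contr by (intro positive_op_norm_sq_le P) auto
    moreover have "Re (cinner x (P x)) = Re (cinner (P x) x)"
      by (metis positive_op_symmetric[OF P])
    moreover have "0 \<le> (norm (P x))\<^sup>2" by simp
    ultimately have "(norm (x - P x))\<^sup>2 \<le> (norm x)\<^sup>2"
      unfolding norm_diff_sq by linarith
    then show "norm (blinfun_apply Q x) \<le> 1 * norm x"
      by (simp add: Q power2_le_iff_abs_le)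
  qed simp
  then obtain Y where lim: "sqrt_iter Q \<longlonglongrightarrow> Y" and Y: "norm Y \<le> 1" "2 *\<^sub>R Y = Q + (Y o\<^sub>L Y)"
    using convergent_sqrt_iter by metis
  have lim': "(\<lambda>n. blinfun_apply (sqrt_iter Q n) x) \<longlonglongrightarrow> Y x" for x
    by (intro blinfun.tendsto lim tendsto_const)
  have scale: "Y (c *\<^sub>C x) = c *\<^sub>C Y x" for c x
  proof (rule LIMSEQ_unique[OF lim'])
    \<comment> \<open>A bounded linear function is linear over the reals only, so complex
      homogeneity has to be carried through the iteration separately.\<close>
    have "sqrt_iter Q n (c *\<^sub>C x) = c *\<^sub>C sqrt_iter Q n x" for n x
      by (induction n arbitrary: x)
        (simp_all add: blinfun.bilinear_simps Q bounded_clinearD(6)[OF bP] scaleC_diff_right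
          scaleC_add_right scaleR_scaleC scaleC_scaleC mult.commute)
    then show "(\<lambda>n. sqrt_iter Q n (c *\<^sub>C x)) \<longlonglongrightarrow> c *\<^sub>C Y x"
      by (simp add: tendsto_scaleC lim')
  qed
  have sym: "cinner (Y x) y = cinner x (Y y)" for x y
  proof (rule LIMSEQ_unique)
    have "cinner (sqrt_iter Q n x) y = cinner x (sqrt_iter Q n y)" for n x y
      by (induction n arbitrary: x y)
        (simp_all add: blinfun.bilinear_simps Q positive_op_symmetric[OF P] cinner_simps scaleR_scaleC)
    then show "(\<lambda>n. cinner (sqrt_iter Q n x) y) \<longlonglongrightarrow> cinner x (Y y)"
      by (simp add: tendsto_cinner lim')
  qed (intro tendsto_intros lim')
  have comm: "C (Y x) = Y (C x)" if C: "bounded_clinear C" "C \<circ> P = P \<circ> C" for C x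
  proof (rule LIMSEQ_unique[OF bounded_linear.tendsto[OF bounded_clinear_imp_linear[OF C(1)] lim']])
    have CP: "C (P x) = P (C x)" for x using C(2) by (metis comp_apply)
    have "C (sqrt_iter Q n x) = sqrt_iter Q n (C x)" for n x
      by (induction n arbitrary: x)
        (simp_all add: blinfun.bilinear_simps Q CP bounded_clinearD[OF C(1)] scaleR_scaleC)
    then show "(\<lambda>n. C (sqrt_iter Q n x)) \<longlonglongrightarrow> Y (C x)"
      by (simp add: lim')
  qed
  define S where "S x = x - Y x" for x
  have bS: "bounded_clinear S"
    unfolding S_def
  proof (intro bounded_clinear_sub bounded_clinear_ident)
    show "bounded_clinear Y"
      unfolding bounded_clinear_def using scale blinfun.bounded_linear_right by blast
  qed
  have "cinner (S x) x \<in> \<real>\<^sub>\<ge>\<^sub>0" for x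
  proof -
    have "cinner (Y x) x = cnj (cinner (Y x) x)"
      using sym[of x x] cinner_commute[of x "Y x"] by simp
    then have "Im (cinner (Y x) x) = 0"
      by (simp add: complex_eq_iff)
    moreover have "Re (cinner (Y x) x) \<le> (norm x)\<^sup>2"
    proof -
      have "Re (cinner (Y x) x) \<le> norm (Y x) * norm x"
        using complex_Re_le_cmod cinner_norm_le order_trans by blast
      also have "norm (Y x) \<le> norm Y * norm x" by (rule norm_blinfun)
      also have "\<dots> \<le> 1 * norm x" using Y(1) by (intro mult_right_mono) auto
      finally show ?thesis by (simp add: power2_eq_square mult_right_mono)
    qed
    ultimately show ?thesis
      by (simp add: S_def complex_nonneg_Reals_iff cinner_diff_left cinner_self del: of_real_power)
  qed
  then have "positive_op S" using bS by (simp add: positive_op_def)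
  moreover have "S \<circ> S = P"
  proof
    fix x
    have "2 *\<^sub>R Y x = x - P x + Y (Y x)"
      using arg_cong[OF Y(2), of "\<lambda>F. blinfun_apply F x"] by (simp add: blinfun.bilinear_simps Q)
    then show "(S \<circ> S) x = P x"
      by (simp add: S_def blinfun.bilinear_simps scaleR_2 algebra_simps)
  qed
  moreover have "C \<circ> S = S \<circ> C" if "bounded_clinear C" "C \<circ> P = P \<circ> C" for C
    using comm[OF that] by (auto simp: S_def bounded_clinear_diff[OF that(1)])
  ultimately show ?thesis using that by blast
qed

text \<open>Dividing by \<open>K\<close> reduces to a contraction, and the root is multiplied by
  \<open>sqrt K\<close> afterwards. Adding 1 to the operator bound keeps \<open>K\<close> positive
  for \<open>P = 0\<close>.\<close>

lemma positive_sqrt_exists: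
  fixes P :: "'h::complex_hilbert \<Rightarrow> 'h"
  assumes P: "positive_op P"
  obtains S where "positive_op S" "S \<circ> S = P"
    "\<And>C. bounded_clinear C \<Longrightarrow> C \<circ> P = P \<circ> C \<Longrightarrow> C \<circ> S = S \<circ> C"
proof -
  have bP: "bounded_clinear P" and pos: "cinner (P x) x \<in> \<real>\<^sub>\<ge>\<^sub>0" for x
    using P by (auto simp: positive_op_def)
  obtain K\<^sub>0 where K\<^sub>0: "K\<^sub>0 \<ge> 0" "\<And>x. norm (P x) \<le> K\<^sub>0 * norm x"
    using bounded_clinear_bound[OF bP] by metis
  define K where "K = K\<^sub>0 + 1"
  have K: "K > 0" "norm (P x) \<le> K * norm x" for x
    using K\<^sub>0(1) K\<^sub>0(2)[of x] norm_ge_zero[of x] unfolding K_def distrib_right by linarith+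
  define P' where "P' x = of_real (1 / K) *\<^sub>C P x" for x
  have "positive_op P'"
    unfolding P'_def positive_op_def using pos K(1)
    by (auto intro!: bounded_clinear_cmult bP simp: cinner_scaleC_left complex_nonneg_Reals_iff)
  moreover have "norm (P' x) \<le> norm x" for x
    using K by (simp add: P'_def norm_divide field_simps)
  ultimately obtain S where S: "positive_op S" "S \<circ> S = P'"
    and comm: "\<And>C. bounded_clinear C \<Longrightarrow> C \<circ> P' = P' \<circ> C \<Longrightarrow> C \<circ> S = S \<circ> C"
    using positive_contraction_sqrt by metis
  have bS: "bounded_clinear S" using S by (simp add: positive_op_def)
  have S2: "S (S x) = P' x" for x using S(2) by (metis comp_apply)
  show ?thesis
  proof (rule that[of "\<lambda>x. of_real (sqrt K) *\<^sub>C S x"])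
    show "positive_op (\<lambda>x. of_real (sqrt K) *\<^sub>C S x)"
      using S K(1) by (auto simp: positive_op_def cinner_scaleC_left complex_nonneg_Reals_iff
          intro!: bounded_clinear_cmult)
    show "(\<lambda>x. of_real (sqrt K) *\<^sub>C S x) \<circ> (\<lambda>x. of_real (sqrt K) *\<^sub>C S x) = P"
      using K(1) by (auto simp: bounded_clinear_scaleC[OF bS] S2 P'_def scaleC_scaleC
          simp flip: of_real_mult)
    show "C \<circ> (\<lambda>x. of_real (sqrt K) *\<^sub>C S x) = (\<lambda>x. of_real (sqrt K) *\<^sub>C S x) \<circ> C"
      if C: "bounded_clinear C" "C \<circ> P = P \<circ> C" for C
    proof -
      have "C \<circ> P' = P' \<circ> C"
        using C(2) by (auto simp: P'_def fun_eq_iff bounded_clinear_scaleC[OF C(1)])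
      from comm[OF C(1) this] show ?thesis
        by (auto simp: fun_eq_iff bounded_clinear_scaleC[OF C(1)])
    qed
  qed
qed

text \<open>By commutation \<open>(S + R)(S - R) = 0\<close>. On \<open>y = (S - R) x\<close> the
  two nonnegative forms therefore add up to zero, so \<open>S y = R y = 0\<close>, and
  \<open>(y, y) = (x, S y - R y)\<close> vanishes.\<close>

lemma positive_sqrt_unique:
  assumes S: "positive_op S" and R: "positive_op R" and eq: "S \<circ> S = R \<circ> R"
    and comm: "S \<circ> R = R \<circ> S"
  shows "S = R"
proof
  fix x
  have bS: "bounded_clinear S" and bR: "bounded_clinear R"
    and pos: "Re (cinner (S x) x) \<ge> 0" "Re (cinner (R x) x) \<ge> 0" for x
    using S R by (auto simp: positive_op_def complex_nonneg_Reals_iff)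
  define y where "y = S x - R x"
  have SR: "S (S x) = R (R x)" "S (R x) = R (S x)"
    using eq comm by (metis comp_apply)+
  have "S y + R y = 0"
    by (simp add: y_def bounded_clinear_diff[OF bS] bounded_clinear_diff[OF bR] SR)
  then have "cinner (S y) y + cinner (R y) y = 0"
    by (metis cinner_add_left cinner_zero_left)
  moreover have "Im (cinner (S y) y) = 0" "Im (cinner (R y) y) = 0"
    using S R by (auto simp: positive_op_def complex_nonneg_Reals_iff)
  ultimately have "cinner (S y) y = 0" "cinner (R y) y = 0"
    using pos(1)[of y] pos(2)[of y] by (auto simp: complex_eq_iff)
  then have "S y = 0" "R y = 0"
    using positive_op_eq_0[OF S] positive_op_eq_0[OF R] by blast+
  have "cinner y y = cinner x (S y) - cinner x (R y)"
    by (subst (1) y_def)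
      (simp add: cinner_diff_left positive_op_symmetric[OF S] positive_op_symmetric[OF R])
  then show "S x = R x"
    using \<open>S y = 0\<close> \<open>R y = 0\<close> by (simp add: y_def)
qed

lemma sqrt_op:
  assumes P: "positive_op P"
  shows positive_sqrt_op: "positive_op (sqrt_op P)"
    and sqrt_op_square: "sqrt_op P (sqrt_op P x) = P x"
    and sqrt_op_commute:
      "bounded_clinear C \<Longrightarrow> C \<circ> P = P \<circ> C \<Longrightarrow> C \<circ> sqrt_op P = sqrt_op P \<circ> C"
proof -
  obtain S where S: "positive_op S" "S \<circ> S = P"
    and comm: "\<And>C. bounded_clinear C \<Longrightarrow> C \<circ> P = P \<circ> C \<Longrightarrow> C \<circ> S = S \<circ> C"
    using positive_sqrt_exists[OF P] by metis
  have "sqrt_op P = S"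
    unfolding sqrt_op_def
  proof (rule the_equality)
    fix R assume R: "positive_op R \<and> R \<circ> R = P"
    then have R: "positive_op R" "R \<circ> R = P" by auto
    \<comment> \<open>Any root commutes with its own square, hence with the constructed root;
      uniqueness among commuting roots is thus enough.\<close>
    then have "R \<circ> P = P \<circ> R"
      by (metis comp_assoc)
    then have "R \<circ> S = S \<circ> R"
      using R(1) comm by (simp add: positive_op_def)
    then show "R = S"
      by (rule positive_sqrt_unique[OF R(1) S(1) trans[OF R(2) S(2)[symmetric]]])
  qed (use S in blast)
  then show "positive_op (sqrt_op P)" "sqrt_op P (sqrt_op P x) = P x"
    "bounded_clinear C \<Longrightarrow> C \<circ> P = P \<circ> C \<Longrightarrow> C \<circ> sqrt_op P = sqrt_op P \<circ> C"
    using S(1) fun_cong[OF S(2), of x] comm by auto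
qed

section \<open>Modulus and sign of a symmetric operator\<close>

lemma abs_op_symmetric:
  assumes T: "bounded_clinear T" and sym: "\<And>x y. cinner (T x) y = cinner x (T y)"
  shows positive_abs_op: "positive_op (abs_op T)"
    and abs_op_square: "abs_op T (abs_op T x) = T (T x)"
    and abs_op_commute: "T (abs_op T x) = abs_op T (T x)"
proof -
  have adj: "cadjoint T = T" by (rule cadjoint_unique) (rule sym)
  have pos: "positive_op (T \<circ> T)"
    using bounded_clinear_compose[OF T T]
    by (auto simp: positive_op_def sym comp_def cinner_self complex_nonneg_Reals_iff)
  show "positive_op (abs_op T)" "abs_op T (abs_op T x) = T (T x)"
    using positive_sqrt_op[OF pos] sqrt_op_square[OF pos] by (simp_all add: abs_op_def adj)
  show "T (abs_op T x) = abs_op T (T x)"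
    using sqrt_op_commute[OF pos T] by (simp add: abs_op_def adj comp_assoc fun_eq_iff)
qed

text \<open>\<open>T x\<close> and \<open>abs_op T x\<close> have equal norms, so sending the latter
  to the former is isometric on the range of the modulus, which is dense by injectivity. The
  remaining identities are checked on that range.\<close>

lemma sign_op_symmetric:
  assumes T: "bounded_clinear T" and sym: "\<And>x y. cinner (T x) y = cinner x (T y)"
    and inj: "\<And>x. T x = 0 \<Longrightarrow> x = 0"
  shows bounded_clinear_sign_op: "bounded_clinear (sign_op T)"
    and sign_op_abs_op: "sign_op T (abs_op T x) = T x"
    and abs_op_sign_op: "abs_op T (sign_op T x) = T x"
    and sign_op_sign_op: "sign_op T (sign_op T x) = x"
proof -
  define N where "N = abs_op T"
  have N: "positive_op N" "\<And>x. N (N x) = T (T x)" "\<And>x. T (N x) = N (T x)"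
    using abs_op_symmetric[OF T sym] by (simp_all add: N_def)
  have bN: "bounded_clinear N" using N(1) by (simp add: positive_op_def)
  have injN: "x = 0" if "N x = 0" for x
    using N(2)[of x] that by (simp add: inj bounded_clinear_zero[OF bN])
  have dense: "closure (range N) = UNIV"
    by (rule dense_range_of_injective_symmetric[OF positive_op_symmetric[OF N(1)] injN])
  have "cinner (T x) (T x) = cinner (N x) (N x)" for x
    by (simp add: sym positive_op_symmetric[OF N(1)] N(2))
  then have norm_eq: "norm (T x) = norm (N x)" for x
    by (simp add: norm_sq_cinner flip: power2_eq_iff_nonneg)
  obtain U where bU: "bounded_clinear U" and UN: "\<And>x. U (N x) = T x"
  proof (rule bounded_clinear_extension[of N T 1])
    show "clinear_on UNIV N" "clinear_on UNIV T"
      by (simp_all add: clinear_on_def bounded_clinearD[OF bN] bounded_clinearD[OF T])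
  qed (use dense norm_eq in auto)
  have eq: "sign_op T = U"
    unfolding sign_op_def N_def[symmetric]
  proof (rule the_equality)
    show "bounded_clinear U \<and> (\<forall>x. U (N x) = T x) \<and> (\<forall>x. T x = 0 \<longrightarrow> U x = 0)"
      using bU UN inj bounded_clinear_zero[OF bU] by auto
    show "V = U" if "bounded_clinear V \<and> (\<forall>x. V (N x) = T x) \<and> (\<forall>x. T x = 0 \<longrightarrow> V x = 0)" for V
      by (rule continuous_dense_ext[OF dense])
        (use that bU UN in \<open>auto simp: bounded_clinear_continuous\<close>)
  qed
  note cont = bounded_clinear_continuous[OF bounded_clinear_compose]
  have NU: "(\<lambda>x. N (U x)) = T"
    by (rule continuous_dense_ext[OF dense cont[OF bN bU] bounded_clinear_continuous[OF T]])
      (auto simp: UN N(3))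
  have UT: "(\<lambda>x. U (T x)) = N"
    by (rule continuous_dense_ext[OF dense cont[OF bU T] bounded_clinear_continuous[OF bN]])
      (auto simp: UN N(2) N(3))
  have UU: "(\<lambda>x. U (U x)) = (\<lambda>x. x)"
    by (rule continuous_dense_ext[OF dense cont[OF bU bU] continuous_on_id])
      (auto simp: UN fun_cong[OF UT])
  show "bounded_clinear (sign_op T)" "sign_op T (abs_op T x) = T x"
    "abs_op T (sign_op T x) = T x" "sign_op T (sign_op T x) = x"
    using bU UN fun_cong[OF NU] fun_cong[OF UU] by (simp_all add: eq N_def)
qed

section \<open>Extensions described by dual pairs of boundary maps\<close>

lemma linear_operatorD:
  assumes "linear_operator T"
  shows linear_operator_unique: "(f, f') \<in> T \<Longrightarrow> (f, f'') \<in> T \<Longrightarrow> f' = f''"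
    and linear_operator_zero: "(0, 0) \<in> T"
    and linear_operator_add: "(f, f') \<in> T \<Longrightarrow> (g, g') \<in> T \<Longrightarrow> (f + g, f' + g') \<in> T"
    and linear_operator_scaleC: "(f, f') \<in> T \<Longrightarrow> (c *\<^sub>C f, c *\<^sub>C f') \<in> T"
  using assms by (auto simp: linear_operator_def single_valued_def)

lemma linear_operator_diff:
  assumes "linear_operator T" "(f, f') \<in> T" "(g, g') \<in> T"
  shows "(f - g, f' - g') \<in> T"
  using linear_operator_add[OF assms(1,2) linear_operator_scaleC[OF assms(1,3), of "-1"]] by simp

lemma linear_operator_op_adjoint:
  assumes "closure (Domain A) = UNIV"
  shows "linear_operator (op_adjoint A)"
proof -
  have "single_valued (op_adjoint A)"
  proof (rule single_valuedI)
    fix g a b assume "(g, a) \<in> op_adjoint A" "(g, b) \<in> op_adjoint A"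
    then have "cinner f a = cinner f b" if "f \<in> Domain A" for f
      using that by (fastforce simp: op_adjoint_def)
    then show "a = b" by (rule cinner_dense_ext[OF assms])
  qed
  then show ?thesis
    unfolding linear_operator_def by (fastforce simp: op_adjoint_def cinner_simps)
qed

section \<open>Resolvents and operator-valued holomorphy\<close>

definition resolvent :: "('a::complex_hilbert \<times> 'a) set \<Rightarrow> complex \<Rightarrow> 'a \<Rightarrow> 'a" where
  "resolvent T z = (SOME R. bounded_clinear R \<and> (\<forall>f y. (f, y + z *\<^sub>C f) \<in> T \<longleftrightarrow> f = R y))"

lemma resolvent:
  assumes "z \<in> resolvent_set T"
  shows bounded_clinear_resolvent: "bounded_clinear (resolvent T z)"
    and resolvent_eq_iff: "(f, y + z *\<^sub>C f) \<in> T \<longleftrightarrow> f = resolvent T z y"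
proof -
  have "\<exists>R. bounded_clinear R \<and> (\<forall>f y. (f, y + z *\<^sub>C f) \<in> T \<longleftrightarrow> f = R y)"
    using assms by (simp add: resolvent_set_def)
  from someI_ex[OF this]
  have "bounded_clinear (resolvent T z) \<and> (\<forall>f y. (f, y + z *\<^sub>C f) \<in> T \<longleftrightarrow> f = resolvent T z y)"
    unfolding resolvent_def .
  then show "bounded_clinear (resolvent T z)" "(f, y + z *\<^sub>C f) \<in> T \<longleftrightarrow> f = resolvent T z y"
    by auto
qed

lemma resolvent_mem:
  "z \<in> resolvent_set T \<Longrightarrow> (resolvent T z y, y + z *\<^sub>C resolvent T z y) \<in> T"
  by (simp add: resolvent_eq_iff)

lemma resolvent_identity:
  assumes "z \<in> resolvent_set T" "w \<in> resolvent_set T"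
  shows "resolvent T w y = resolvent T z y + (w - z) *\<^sub>C resolvent T z (resolvent T w y)"
proof -
  define f where "f = resolvent T w y"
  \<comment> \<open>Solving at \<open>w\<close> with datum \<open>y\<close> is the same as solving
    at \<open>z\<close> with the datum \<open>y + (w - z) f\<close>.\<close>
  have "(f, (y + (w - z) *\<^sub>C f) + z *\<^sub>C f) \<in> T"
    using resolvent_mem[OF assms(2), of y] by (simp add: f_def scaleC_diff_left)
  then have "f = resolvent T z (y + (w - z) *\<^sub>C f)"
    by (simp only: resolvent_eq_iff[OF assms(1)])
  also have "\<dots> = resolvent T z y + (w - z) *\<^sub>C resolvent T z f"
    by (simp add: bounded_clinearD[OF bounded_clinear_resolvent[OF assms(1)]])
  finally show ?thesis by (simp add: f_def)
qed

text \<open>\<open>T\<close> is the set of all pairs \<open>(R x, x + z *\<^sub>C R x)\<close>.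
  Testing the adjoint relation on these pairs, the terms with \<open>z\<close> cancel and what
  remains says \<open>f = cadjoint R y\<close>.\<close>

lemma resolvent_set_op_adjoint:
  assumes z: "z \<in> resolvent_set T"
  shows "cnj z \<in> resolvent_set (op_adjoint T)"
proof -
  define R where "R = resolvent T z"
  have R: "bounded_clinear R" unfolding R_def by (rule bounded_clinear_resolvent[OF z])
  have mem: "(f, f') \<in> T \<longleftrightarrow> f = R (f' - z *\<^sub>C f)" for f f'
    using resolvent_eq_iff[OF z, of f "f' - z *\<^sub>C f"] by (simp add: R_def)
  have "(f, y + cnj z *\<^sub>C f) \<in> op_adjoint T \<longleftrightarrow> f = cadjoint R y" for f y
  proof -
    have "(f, y + cnj z *\<^sub>C f) \<in> op_adjoint T
        \<longleftrightarrow> (\<forall>x. cinner (x + z *\<^sub>C R x) f = cinner (R x) (y + cnj z *\<^sub>C f))"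
    proof
      assume "(f, y + cnj z *\<^sub>C f) \<in> op_adjoint T"
      moreover have "(R x, x + z *\<^sub>C R x) \<in> T" for x by (simp add: mem)
      ultimately show "\<forall>x. cinner (x + z *\<^sub>C R x) f = cinner (R x) (y + cnj z *\<^sub>C f)"
        unfolding op_adjoint_def by blast
    next
      assume *: "\<forall>x. cinner (x + z *\<^sub>C R x) f = cinner (R x) (y + cnj z *\<^sub>C f)"
      have "cinner g' f = cinner g (y + cnj z *\<^sub>C f)" if "(g, g') \<in> T" for g g'
        using that *[rule_format, of "g' - z *\<^sub>C g"] unfolding mem by simp
      then show "(f, y + cnj z *\<^sub>C f) \<in> op_adjoint T"
        unfolding op_adjoint_def by blast
    qed
    also have "\<dots> \<longleftrightarrow> (\<forall>x. cinner x f = cinner x (cadjoint R y))"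
      by (simp add: cinner_simps cinner_cadjoint[OF R])
    also have "\<dots> \<longleftrightarrow> f = cadjoint R y"
      using cinner_ext_right by blast
    finally show ?thesis .
  qed
  then show ?thesis
    unfolding resolvent_set_def using bounded_clinear_cadjoint[OF R] by blast
qed

text \<open>Carries holomorphy between different spaces: the error of the difference quotient is
  sandwiched between the fixed operators \<open>a\<close> and \<open>b\<close>, and the operator
  norm is submultiplicative.\<close>

lemma op_holomorphic_on_affine:
  fixes Q :: "complex \<Rightarrow> 'h::complex_hilbert \<Rightarrow> 'k::complex_hilbert"
  assumes Q: "op_holomorphic_on Q S" and a: "bounded_clinear a" and b: "bounded_clinear b"
    and C: "bounded_clinear C" and W: "\<And>z x. z \<in> S \<Longrightarrow> W z x = C x + a (Q z (b x))"
  shows "op_holomorphic_on W S"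
  unfolding op_holomorphic_on_def
proof (intro conjI ballI)
  have bQ: "bounded_clinear (Q z)" if "z \<in> S" for z
    using Q that by (simp add: op_holomorphic_on_def)
  show "bounded_clinear (W z)" if "z \<in> S" for z
  proof -
    have "W z = (\<lambda>x. C x + a (Q z (b x)))" using W[OF that] by blast
    then show ?thesis
      using bounded_clinear_plus[OF C bounded_clinear_compose[OF a
          bounded_clinear_compose[OF bQ[OF that] b]]] by simp
  qed
  fix z assume z: "z \<in> S"
  then obtain D where D: "bounded_clinear D"
    and lim: "((\<lambda>w. onorm (\<lambda>x. (1 / (w - z)) *\<^sub>C (Q w x - Q z x) - D x)) \<longlongrightarrow> 0) (at z within S)"
    using Q unfolding op_holomorphic_on_def by blast
  define E where "E w x = (1 / (w - z)) *\<^sub>C (Q w x - Q z x) - D x" for w x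
  have bE: "bounded_clinear (E w)" if "w \<in> S" for w
    unfolding E_def using that z
    by (intro bounded_clinear_sub bounded_clinear_cmult bQ D)
  have eq: "(\<lambda>x. (1 / (w - z)) *\<^sub>C (W w x - W z x) - a (D (b x))) = (\<lambda>x. a (E w (b x)))"
    if "w \<in> S" for w
    using that z by (simp add: W E_def bounded_clinearD[OF a])
  have le: "onorm (\<lambda>x. a (E w (b x))) \<le> onorm a * onorm (E w) * onorm b" if "w \<in> S" for w
  proof -
    note bl = bounded_clinear_imp_linear
    have "onorm (a \<circ> (E w \<circ> b)) \<le> onorm a * onorm (E w \<circ> b)"
      using bounded_clinear_compose[OF bE[OF that] b]
      by (intro onorm_compose bl[OF a]) (simp add: comp_def bl)
    also have "\<dots> \<le> onorm a * (onorm (E w) * onorm b)"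
      by (intro mult_left_mono onorm_compose bl[OF bE[OF that]] bl[OF b] onorm_pos_le bl[OF a])
    finally show ?thesis by (simp add: comp_def mult.assoc)
  qed
  have "((\<lambda>w. onorm (\<lambda>x. (1 / (w - z)) *\<^sub>C (W w x - W z x) - a (D (b x)))) \<longlongrightarrow> 0) (at z within S)"
  proof (rule Lim_null_comparison)
    show "((\<lambda>w. onorm a * onorm (E w) * onorm b) \<longlongrightarrow> 0) (at z within S)"
      using tendsto_mult[OF tendsto_mult[OF tendsto_const[of "onorm a"] lim] tendsto_const[of "onorm b"]]
      unfolding E_def[abs_def] by simp
    show "\<forall>\<^sub>F w in at z within S. norm (onorm (\<lambda>x. (1 / (w - z)) *\<^sub>C (W w x - W z x) - a (D (b x))))
        \<le> onorm a * onorm (E w) * onorm b"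
      unfolding eventually_at_filter
    proof (intro always_eventually allI impI)
      fix w assume w: "w \<in> S"
      have "0 \<le> onorm (\<lambda>x. a (E w (b x)))"
        by (intro onorm_pos_le bounded_clinear_imp_linear bounded_clinear_compose[OF a]
            bounded_clinear_compose[OF bE[OF w] b])
      then show "norm (onorm (\<lambda>x. (1 / (w - z)) *\<^sub>C (W w x - W z x) - a (D (b x))))
          \<le> onorm a * onorm (E w) * onorm b"
        unfolding eq[OF w] using le[OF w] by simp
    qed
  qed
  then show "\<exists>D. bounded_clinear D \<and>
      ((\<lambda>w. onorm (\<lambda>x. (1 / (w - z)) *\<^sub>C (W w x - W z x) - D x)) \<longlongrightarrow> 0) (at z within S)"
    using bounded_clinear_compose[OF a bounded_clinear_compose[OF D b]] by blast
qed

text \<open>The symmetry between \<open>(X, Y)\<close> and \<open>(X', Y')\<close> provides the solution operators with everywhere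
  defined adjoints, so that they are bounded by the Hellinger-Toeplitz theorem.\<close>

locale dual_boundary_maps =
  fixes A :: "('a::complex_hilbert \<times> 'a) set" and X Y X' Y' :: "'a \<Rightarrow> 'h::complex_hilbert"
  assumes A: "closed_densely_defined_symmetric A"
    and linear: "clinear_on (Domain (op_adjoint A)) X" "clinear_on (Domain (op_adjoint A)) Y"
      "clinear_on (Domain (op_adjoint A)) X'" "clinear_on (Domain (op_adjoint A)) Y'"
    and green: "(f, f') \<in> op_adjoint A \<Longrightarrow> (g, g') \<in> op_adjoint A \<Longrightarrow>
      cinner f' g - cinner f g' = cinner (Y f) (X' g) - cinner (X f) (Y' g)"
    and onto: "\<exists>f f'. (f, f') \<in> op_adjoint A \<and> X f = h \<and> Y f = k"
    and onto': "\<exists>f f'. (f, f') \<in> op_adjoint A \<and> X' f = h \<and> Y' f = k"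
begin

lemma dual: "dual_boundary_maps A X' Y' X Y"
proof
  show "cinner f' g - cinner f g' = cinner (Y' f) (X g) - cinner (X' f) (Y g)"
    if "(f, f') \<in> op_adjoint A" "(g, g') \<in> op_adjoint A" for f f' g g'
  proof -
    have "cnj (cinner g' f - cinner g f') = cnj (cinner (Y g) (X' f) - cinner (X g) (Y' f))"
      by (simp only: green[OF that(2,1)])
    then have "cinner f g' - cinner f' g = cinner (X' f) (Y g) - cinner (Y' f) (X g)"
      by (simp only: complex_cnj_diff cinner_commute[symmetric])
    then show ?thesis by (simp add: algebra_simps)
  qed
qed (use A linear onto onto' in auto)

lemma linear_op_adjoint: "linear_operator (op_adjoint A)"
  using A linear_operator_op_adjoint by (auto simp: closed_densely_defined_symmetric_def)

lemma A_subset: "A \<subseteq> op_adjoint A"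
  using A by (simp add: closed_densely_defined_symmetric_def)

lemma maps_add:
  assumes "(f, f') \<in> op_adjoint A" "(g, g') \<in> op_adjoint A"
  shows "X (f + g) = X f + X g" "Y (f + g) = Y f + Y g"
  using assms linear by (blast intro: clinear_on_add)+

lemma maps_scaleC:
  assumes "(f, f') \<in> op_adjoint A"
  shows "X (c *\<^sub>C f) = c *\<^sub>C X f" "Y (c *\<^sub>C f) = c *\<^sub>C Y f"
  using assms linear by (blast intro: clinear_on_scaleC)+

lemma maps_diff:
  assumes "(f, f') \<in> op_adjoint A" "(g, g') \<in> op_adjoint A"
  shows "X (f - g) = X f - X g" "Y (f - g) = Y f - Y g"
  using maps_add[OF assms(1) linear_operator_scaleC[OF linear_op_adjoint assms(2), of "-1"]]
    maps_scaleC[OF assms(2), of "-1"] by simp_all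

lemma maps_zero: "X 0 = 0" "Y 0 = 0"
  using maps_scaleC[OF linear_operator_zero[OF linear_op_adjoint], of 0] by simp_all

text \<open>For \<open>(f, f')\<close> in \<open>A\<close> the left side of Green's identity
  vanishes, and since \<open>(X', Y')\<close> is onto, each of \<open>X f\<close> and
  \<open>Y f\<close> can be paired with itself. The converse is
  \<open>A = op_adjoint (op_adjoint A)\<close>.\<close>

lemma mem_A_iff: "(f, f') \<in> A \<longleftrightarrow> (f, f') \<in> op_adjoint A \<and> X f = 0 \<and> Y f = 0"
proof (intro iffI conjI)
  assume f: "(f, f') \<in> A"
  then show f': "(f, f') \<in> op_adjoint A" using A_subset by blast
  have eq: "cinner (Y f) (X' g) = cinner (X f) (Y' g)" if "(g, g') \<in> op_adjoint A" for g g'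
  proof -
    have "cinner f' g = cinner f g'"
      using that f unfolding op_adjoint_def by blast
    with green[OF f' that] show ?thesis by simp
  qed
  show "X f = 0" using onto'[of 0 "X f"] eq by force
  show "Y f = 0" using onto'[of "Y f" 0] eq by force
next
  assume f: "(f, f') \<in> op_adjoint A \<and> X f = 0 \<and> Y f = 0"
  have "cinner g' f = cinner g f'" if "(g, g') \<in> op_adjoint A" for g g'
  proof -
    have "cinner f' g = cinner f g'" using green[of f f' g g'] f that by simp
    then show ?thesis by (metis cinner_commute)
  qed
  then have "(f, f') \<in> op_adjoint (op_adjoint A)"
    by (auto simp: op_adjoint_def[of "op_adjoint A"])
  then show "(f, f') \<in> A"
    using A by (simp add: op_adjoint_op_adjoint closed_densely_defined_symmetric_def)
qed

lemma op_adjoint_ext_zero: "op_adjoint (ext_zero A Y) = ext_zero A Y'"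
proof (intro set_eqI iffI; clarify)
  fix g g' assume g: "(g, g') \<in> op_adjoint (ext_zero A Y)"
  have eq: "cinner f' g = cinner f g'" if "(f, f') \<in> op_adjoint A" "Y f = 0" for f f'
    using g that unfolding op_adjoint_def[of "ext_zero A Y"] by (auto simp: ext_zero_def)
  have g': "(g, g') \<in> op_adjoint A"
    using eq mem_A_iff by (auto simp: op_adjoint_def[of A])
  \<comment> \<open>With this test element Green's identity reduces to minus the squared norm of
    \<open>Y' g\<close>.\<close>
  obtain f f' where f: "(f, f') \<in> op_adjoint A" "X f = Y' g" "Y f = 0"
    using onto by blast
  then have "Y' g = 0"
    using green[OF f(1) g'] eq[OF f(1,3)] by simp
  with g' show "(g, g') \<in> ext_zero A Y'" by (simp add: ext_zero_def)
next
  fix g g' assume "(g, g') \<in> ext_zero A Y'"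
  then have g: "(g, g') \<in> op_adjoint A" "Y' g = 0" by (auto simp: ext_zero_def)
  have "cinner f' g = cinner f g'" if "(f, f') \<in> ext_zero A Y" for f f'
    using green[of f f' g g'] that g by (simp add: ext_zero_def)
  then show "(g, g') \<in> op_adjoint (ext_zero A Y)"
    unfolding op_adjoint_def[of "ext_zero A Y"] by blast
qed

lemma linear_operator_ext_zero: "linear_operator (ext_zero A Y)"
  unfolding linear_operator_def
proof (intro conjI)
  show "single_valued (ext_zero A Y)"
    using linear_operator_unique[OF linear_op_adjoint]
    by (auto simp: single_valued_def ext_zero_def)
qed (auto simp: ext_zero_def maps_zero maps_add maps_scaleC linear_operator_zero linear_op_adjoint
    linear_operator_add linear_operator_scaleC)

lemma proper_extension_ext_zero: "proper_extension A (ext_zero A Y)"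
  using linear_operator_ext_zero mem_A_iff by (auto simp: proper_extension_def ext_zero_def)

section \<open>Solution operators on the kernel of \<open>op_adjoint A - z\<close>\<close>

definition defect_solution :: "complex \<Rightarrow> 'h \<Rightarrow> 'a" where
  "defect_solution z k = (SOME u. (u, z *\<^sub>C u) \<in> op_adjoint A \<and> Y u = k)"

context
  fixes z assumes z: "z \<in> resolvent_set (ext_zero A Y)"
begin

lemma resolvent_ext_zero_mem:
  "(resolvent (ext_zero A Y) z y, y + z *\<^sub>C resolvent (ext_zero A Y) z y) \<in> op_adjoint A"
  "Y (resolvent (ext_zero A Y) z y) = 0"
  using resolvent_mem[OF z, of y] by (auto simp: ext_zero_def)

text \<open>Every preimage of \<open>k\<close> under \<open>Y\<close> splits into an element of the
  domain of the extension, where \<open>Y\<close> vanishes, and an element of the kernel; the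
  resolvent supplies the first summand. The result is the gamma field of the extension.\<close>

lemma defect_solution:
  "(defect_solution z k, z *\<^sub>C defect_solution z k) \<in> op_adjoint A" "Y (defect_solution z k) = k"
proof -
  obtain \<phi> \<phi>' where \<phi>: "(\<phi>, \<phi>') \<in> op_adjoint A" "Y \<phi> = k" using onto by blast
  define r where "r = resolvent (ext_zero A Y) z (\<phi>' - z *\<^sub>C \<phi>)"
  have r: "(r, (\<phi>' - z *\<^sub>C \<phi>) + z *\<^sub>C r) \<in> op_adjoint A" "Y r = 0"
    unfolding r_def by (rule resolvent_ext_zero_mem)+
  have "(\<phi> - r, z *\<^sub>C (\<phi> - r)) \<in> op_adjoint A" "Y (\<phi> - r) = k"
    using linear_operator_diff[OF linear_op_adjoint \<phi>(1) r(1)] maps_diff[OF \<phi>(1) r(1)] \<phi>(2) r(2)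
    by (simp_all add: scaleC_diff_right)
  then have "\<exists>u. (u, z *\<^sub>C u) \<in> op_adjoint A \<and> Y u = k" by blast
  from someI_ex[OF this]
  show "(defect_solution z k, z *\<^sub>C defect_solution z k) \<in> op_adjoint A"
    "Y (defect_solution z k) = k"
    by (simp_all add: defect_solution_def)
qed

lemma defect_solution_unique:
  assumes u: "(u, z *\<^sub>C u) \<in> op_adjoint A"
  shows "defect_solution z (Y u) = u"
proof -
  define d where "d = defect_solution z (Y u) - u"
  have "(d, 0 + z *\<^sub>C d) \<in> ext_zero A Y"
    using linear_operator_diff[OF linear_op_adjoint defect_solution(1) u]
      maps_diff[OF defect_solution(1) u] defect_solution(2)
    by (simp add: d_def ext_zero_def scaleC_diff_right)
  then have "d = resolvent (ext_zero A Y) z 0"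
    by (simp only: resolvent_eq_iff[OF z])
  then show ?thesis
    by (simp add: d_def bounded_clinear_zero[OF bounded_clinear_resolvent[OF z]])
qed

lemma cnj_resolvent_set: "cnj z \<in> resolvent_set (ext_zero A Y')"
  using resolvent_set_op_adjoint[OF z] by (simp add: op_adjoint_ext_zero)

end

text \<open>The dual resolvent is taken at \<open>cnj z\<close> so that the spectral terms in
  Green's identity cancel; \<open>Y' v = 0\<close> removes the second boundary term.\<close>

lemma cinner_defect_solution:
  assumes z: "z \<in> resolvent_set (ext_zero A Y)"
  shows "cinner (defect_solution z k) y = cinner k (- X' (resolvent (ext_zero A Y') (cnj z) y))"
proof -
  interpret dual: dual_boundary_maps A X' Y' X Y by (rule dual)
  define u v where "u = defect_solution z k" and "v = resolvent (ext_zero A Y') (cnj z) y"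
  have u: "(u, z *\<^sub>C u) \<in> op_adjoint A" "Y u = k"
    unfolding u_def by (rule defect_solution[OF z])+
  have v: "(v, y + cnj z *\<^sub>C v) \<in> op_adjoint A" "Y' v = 0"
    unfolding v_def by (rule dual.resolvent_ext_zero_mem[OF cnj_resolvent_set[OF z]])+
  have "- cinner u y = cinner k (X' v)"
    using green[OF u(1) v(1)] u(2) v(2) by (simp add: cinner_simps)
  then show ?thesis
    by (metis cinner_minus_right minus_minus u_def v_def)
qed

lemma bounded_clinear_defect_solution:
  "z \<in> resolvent_set (ext_zero A Y) \<Longrightarrow> bounded_clinear (defect_solution z)"
  by (rule hellinger_toeplitz) (rule cinner_defect_solution)

text \<open>\<open>X\<close> alone need not be continuous for the norm of the space. After the
  resolvent it has, up to sign, the gamma field of the dual maps as its adjoint.\<close>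

lemma bounded_clinear_map_resolvent:
  assumes z: "z \<in> resolvent_set (ext_zero A Y)"
  shows "bounded_clinear (\<lambda>y. X (resolvent (ext_zero A Y) z y))"
proof -
  interpret dual: dual_boundary_maps A X' Y' X Y by (rule dual)
  have "bounded_clinear (\<lambda>y. - X (resolvent (ext_zero A Y) z y))"
  proof (rule hellinger_toeplitz)
    show "cinner (- X (resolvent (ext_zero A Y) z y)) k = cinner y (dual.defect_solution (cnj z) k)" for y k
      using dual.cinner_defect_solution[OF cnj_resolvent_set[OF z], of k y]
      by (metis cinner_commute complex_cnj_cnj)
  qed
  from bounded_clinear_uminus[OF this] show ?thesis by simp
qed

text \<open>This is \<open>Q(z)\<close> of the overview when \<open>Y\<close> describes
  \<open>ABstar\<close>. For \<open>Y = \<Gamma>\<^sub>0\<close> and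
  \<open>X = - \<Gamma>\<^sub>1\<close> it is \<open>- M(z)\<close>.\<close>

definition transfer :: "complex \<Rightarrow> 'h \<Rightarrow> 'h" where
  "transfer z k = X (defect_solution z k)"

lemma bounded_clinear_transfer:
  assumes z: "z \<in> resolvent_set (ext_zero A Y)"
  shows "bounded_clinear (transfer z)"
proof (rule hellinger_toeplitz)
  interpret dual: dual_boundary_maps A X' Y' X Y by (rule dual)
  show "cinner (transfer z k) l = cinner k (dual.transfer (cnj z) l)" for k l
    using green[OF defect_solution(1)[OF z] dual.defect_solution(1)[OF cnj_resolvent_set[OF z]], of k l]
    by (simp add: transfer_def dual.transfer_def cinner_scaleC_left cinner_scaleC_right
        defect_solution(2)[OF z] dual.defect_solution(2)[OF cnj_resolvent_set[OF z]])
qed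

text \<open>The right-hand side lies in the kernel at \<open>w\<close>, and the resolvent term does
  not change the value of \<open>Y\<close>; uniqueness of the solution does the rest.\<close>

lemma defect_solution_diff:
  assumes z: "z \<in> resolvent_set (ext_zero A Y)" and w: "w \<in> resolvent_set (ext_zero A Y)"
  shows "defect_solution w k
    = defect_solution z k + (w - z) *\<^sub>C resolvent (ext_zero A Y) w (defect_solution z k)"
proof -
  define u r where "u = defect_solution z k" and "r = resolvent (ext_zero A Y) w u"
  have u: "(u, z *\<^sub>C u) \<in> op_adjoint A" "Y u = k"
    unfolding u_def by (rule defect_solution[OF z])+
  have r: "(r, u + w *\<^sub>C r) \<in> op_adjoint A" "Y r = 0"
    unfolding r_def by (rule resolvent_ext_zero_mem[OF w])+
  note r' = linear_operator_scaleC[OF linear_op_adjoint r(1), of "w - z"]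
  have "z *\<^sub>C u + (w - z) *\<^sub>C (u + w *\<^sub>C r) = w *\<^sub>C (u + (w - z) *\<^sub>C r)"
    by (simp add: scaleC_add_right scaleC_diff_left scaleC_diff_right scaleC_scaleC algebra_simps)
  then have "(u + (w - z) *\<^sub>C r, w *\<^sub>C (u + (w - z) *\<^sub>C r)) \<in> op_adjoint A"
    using linear_operator_add[OF linear_op_adjoint u(1) r'] by simp
  from defect_solution_unique[OF w this] show ?thesis
    using maps_add(2)[OF u(1) r'] maps_scaleC(2)[OF r(1), of "w - z"] u(2) r(2)
    by (simp flip: u_def r_def)
qed

text \<open>The resolvent identity is applied once more so that \<open>X\<close> is only met in
  front of \<open>R z\<close> at the fixed point \<open>z\<close>, where the product is bounded. The
  moving point \<open>w\<close> enters the remainder only through \<open>R w\<close>, which needs a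
  norm bound alone.\<close>

lemma transfer_expansion:
  fixes k
  assumes z: "z \<in> resolvent_set (ext_zero A Y)" and w: "w \<in> resolvent_set (ext_zero A Y)"
  defines "R \<equiv> resolvent (ext_zero A Y)" and "u \<equiv> defect_solution z k"
  shows "transfer w k = transfer z k + (w - z) *\<^sub>C X (R z u) + (w - z)\<^sup>2 *\<^sub>C X (R z (R w u))"
proof -
  have mem: "(defect_solution z k, z *\<^sub>C defect_solution z k) \<in> op_adjoint A"
    and Rw: "(R w u, u + w *\<^sub>C R w u) \<in> op_adjoint A"
    and Rz: "\<And>y. (R z y, y + z *\<^sub>C R z y) \<in> op_adjoint A"
    unfolding R_def
    by (rule defect_solution(1)[OF z] resolvent_ext_zero_mem(1)[OF w] resolvent_ext_zero_mem(1)[OF z])+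
  have "X (R w u) = X (R z u) + (w - z) *\<^sub>C X (R z (R w u))"
    using resolvent_identity[OF z w, of u]
      maps_add(1)[OF Rz linear_operator_scaleC[OF linear_op_adjoint Rz], of u "w - z" "R w u"]
      maps_scaleC(1)[OF Rz, of "w - z" "R w u"]
    by (simp add: R_def)
  then show ?thesis
    using defect_solution_diff[OF z w, of k]
      maps_add(1)[OF mem linear_operator_scaleC[OF linear_op_adjoint Rw], of "w - z"]
      maps_scaleC(1)[OF Rw, of "w - z"]
    by (simp add: transfer_def R_def u_def scaleC_add_right scaleC_scaleC power2_eq_square)
qed

lemma op_holomorphic_on_transfer: "op_holomorphic_on transfer (resolvent_set (ext_zero A Y))"
  unfolding op_holomorphic_on_def
proof (intro conjI ballI)
  fix z assume z: "z \<in> resolvent_set (ext_zero A Y)"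
  then show "bounded_clinear (transfer z)" by (rule bounded_clinear_transfer)
  define R where "R = resolvent (ext_zero A Y)"
  define D where "D k = X (R z (defect_solution z k))" for k
  have D: "bounded_clinear D"
    unfolding D_def R_def
    using bounded_clinear_compose[OF bounded_clinear_map_resolvent[OF z] bounded_clinear_defect_solution[OF z]] .
  obtain a where a: "a \<ge> 0" "\<And>y. norm (R z y) \<le> a * norm y"
    unfolding R_def using bounded_clinear_bound[OF bounded_clinear_resolvent[OF z]] by metis
  obtain b where b: "b \<ge> 0" "\<And>y. norm (X (R z y)) \<le> b * norm y"
    unfolding R_def using bounded_clinear_bound[OF bounded_clinear_map_resolvent[OF z]] by metis
  obtain c where c: "c \<ge> 0" "\<And>k. norm (defect_solution z k) \<le> c * norm k"
    using bounded_clinear_bound[OF bounded_clinear_defect_solution[OF z]] by metis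
  have bound: "onorm (\<lambda>k. (1 / (w - z)) *\<^sub>C (transfer w k - transfer z k) - D k)
      \<le> cmod (w - z) * (b * (2 * a) * c)"
    if w: "w \<in> resolvent_set (ext_zero A Y)" "w \<noteq> z" "cmod (w - z) * a \<le> 1/2" for w
  proof (rule onorm_bound)
    have Rw: "norm (R w y) \<le> 2 * a * norm y" for y
    proof -
      have "norm (R w y) \<le> norm (R z y) + cmod (w - z) * norm (R z (R w y))"
        using norm_triangle_ineq[of "R z y" "(w - z) *\<^sub>C R z (R w y)"]
          resolvent_identity[OF z w(1), of y] by (simp add: R_def)
      \<comment> \<open>Near \<open>z\<close> the term with \<open>R w\<close> is at most half of
        the left side and is absorbed, which explains the constant \<open>2 * a\<close>.\<close>
      also have "\<dots> \<le> a * norm y + cmod (w - z) * (a * norm (R w y))"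
        by (intro add_mono mult_left_mono a) auto
      also have "\<dots> \<le> a * norm y + 1/2 * norm (R w y)"
        using mult_right_mono[OF w(3), of "norm (R w y)"] by simp
      finally show ?thesis by simp
    qed
    fix k
    have "(1 / (w - z)) *\<^sub>C (transfer w k - transfer z k) - D k
        = (w - z) *\<^sub>C X (R z (R w (defect_solution z k)))"
      using transfer_expansion[OF z w(1), of k] w(2)
      by (simp add: D_def R_def scaleC_add_right scaleC_scaleC power2_eq_square)
    also have "norm \<dots> \<le> cmod (w - z) * (b * (2 * a * (c * norm k)))"
      using a(1) b(1) by (simp, intro mult_left_mono order_trans[OF b(2)] order_trans[OF Rw] c(2)) auto
    finally show "norm ((1 / (w - z)) *\<^sub>C (transfer w k - transfer z k) - D k)
        \<le> cmod (w - z) * (b * (2 * a) * c) * norm k"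
      by (simp add: mult.assoc)
  qed (use a b c in auto)
  have "((\<lambda>w. onorm (\<lambda>k. (1 / (w - z)) *\<^sub>C (transfer w k - transfer z k) - D k)) \<longlongrightarrow> 0)
      (at z within resolvent_set (ext_zero A Y))"
  proof (rule Lim_null_comparison)
    have lim: "((\<lambda>w. cmod (w - z) * K) \<longlongrightarrow> 0) (at z within resolvent_set (ext_zero A Y))" for K
      by (rule tendsto_eq_intros refl | simp)+
    then show "((\<lambda>w. cmod (w - z) * (b * (2 * a) * c)) \<longlongrightarrow> 0) (at z within resolvent_set (ext_zero A Y))" .
    have "\<forall>\<^sub>F w in at z within resolvent_set (ext_zero A Y). cmod (w - z) * a < 1/2"
      by (rule order_tendstoD(2)[OF lim]) simp
    moreover have "\<forall>\<^sub>F w in at z within resolvent_set (ext_zero A Y).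
        w \<in> resolvent_set (ext_zero A Y) \<and> w \<noteq> z"
      by (auto simp: eventually_at_filter)
    ultimately show "\<forall>\<^sub>F w in at z within resolvent_set (ext_zero A Y).
        norm (onorm (\<lambda>k. (1 / (w - z)) *\<^sub>C (transfer w k - transfer z k) - D k))
          \<le> cmod (w - z) * (b * (2 * a) * c)"
    proof eventually_elim
      case (elim w)
      have "bounded_linear (\<lambda>k. (1 / (w - z)) *\<^sub>C (transfer w k - transfer z k) - D k)"
        using elim z
        by (intro bounded_clinear_imp_linear bounded_clinear_sub bounded_clinear_cmult
            bounded_clinear_transfer D) auto
      from onorm_pos_le[OF this] show ?case
        using bound[of w] elim by simp
    qed
  qed
  with D show "\<exists>D. bounded_clinear D \<and>
      ((\<lambda>w. onorm (\<lambda>k. (1 / (w - z)) *\<^sub>C (transfer w k - transfer z k) - D k)) \<longlongrightarrow> 0)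
        (at z within resolvent_set (ext_zero A Y))"
    by blast
qed

end

section \<open>The completion in the energy norm\<close>

text \<open>Polarization across two target spaces. A completion is specified by its norm only; this
  recovers its inner product.\<close>

lemma cinner_eq_of_norm_eq:
  assumes f: "clinear_on UNIV f" and g: "clinear_on UNIV g" and norm: "\<And>x. norm (f x) = norm (g x)"
  shows "cinner (f x) (f y) = cinner (g x) (g y)"
proof -
  have Re: "Re (cinner (f x) (f y)) = Re (cinner (g x) (g y))" for x y
    using norm_add_sq[of "f x" "f y"] norm_add_sq[of "g x" "g y"] norm[of x] norm[of y] norm[of "x + y"]
    by (simp add: clinear_on_add[OF f] clinear_on_add[OF g])
  have "Im (cinner (f x) (f y)) = Im (cinner (g x) (g y))"
    using Re[of x "\<i> *\<^sub>C y"]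
    by (simp add: clinear_on_scaleC[OF f] clinear_on_scaleC[OF g] cinner_scaleC_right)
  with Re show ?thesis by (simp add: complex_eq_iff)
qed

lemma bounded_clinear_imp_clinear_on: "bounded_clinear T \<Longrightarrow> clinear_on S T"
  by (simp add: clinear_on_def bounded_clinearD)

locale energy_completion =
  fixes T :: "'h::complex_hilbert \<Rightarrow> 'h" and \<iota> :: "'h \<Rightarrow> 'e::complex_hilbert"
  assumes T: "bounded_clinear T" and sym: "cinner (T x) y = cinner x (T y)"
    and inj: "T x = 0 \<Longrightarrow> x = 0"
    and completion: "is_completion (\<lambda>h. norm (sqrt_op (abs_op T) h)) \<iota>"
begin

lemma dense: "closure (range \<iota>) = UNIV"
  and clinear_embedding: "clinear_on UNIV \<iota>"
  and norm_embedding: "norm (\<iota> h) = norm (sqrt_op (abs_op T) h)"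
  using completion by (auto simp: is_completion_def)

lemma positive_sqrt_abs: "positive_op (sqrt_op (abs_op T))"
  by (intro positive_sqrt_op positive_abs_op T sym)

lemma bounded_clinear_sqrt_abs: "bounded_clinear (sqrt_op (abs_op T))"
  using positive_sqrt_abs by (simp add: positive_op_def)

lemma cinner_embedding: "cinner (\<iota> x) (\<iota> y) = cinner (abs_op T x) y"
proof -
  have "cinner (\<iota> x) (\<iota> y) = cinner (sqrt_op (abs_op T) x) (sqrt_op (abs_op T) y)"
    by (intro cinner_eq_of_norm_eq clinear_embedding norm_embedding bounded_clinear_imp_clinear_on
        bounded_clinear_sqrt_abs)
  also have "\<dots> = cinner (abs_op T x) y"
    by (simp add: sqrt_op_square positive_abs_op[OF T sym] flip: positive_op_symmetric[OF positive_sqrt_abs])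
  finally show ?thesis .
qed

lemma bounded_clinear_embedding: "bounded_clinear \<iota>"
proof -
  obtain K where "\<And>x. norm (sqrt_op (abs_op T) x) \<le> K * norm x"
    using bounded_clinear_bound[OF bounded_clinear_sqrt_abs] by metis
  then show ?thesis
    using clinear_embedding by (intro bounded_clinearI[of \<iota> K]) (auto simp: clinear_on_def norm_embedding)
qed

lemmas sign = sign_op_symmetric[OF T sym inj]

text \<open>In the energy inner product the sign meets the modulus in either slot, and their product
  is \<open>T\<close>.\<close>

lemma sign_symmetric: "cinner (\<iota> (sign_op T x)) (\<iota> y) = cinner (T x) y"
  "cinner (\<iota> x) (\<iota> (sign_op T y)) = cinner (T x) y"
proof -
  note abs_sym = positive_op_symmetric[OF positive_abs_op[OF T sym]]
  show "cinner (\<iota> (sign_op T x)) (\<iota> y) = cinner (T x) y"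
    by (simp add: cinner_embedding sign)
  show "cinner (\<iota> x) (\<iota> (sign_op T y)) = cinner (T x) y"
    by (simp add: cinner_embedding abs_sym sign sym)
qed

lemma norm_sign: "norm (\<iota> (sign_op T x)) = norm (\<iota> x)"
proof -
  have "cinner (\<iota> (sign_op T x)) (\<iota> (sign_op T x)) = cinner (\<iota> x) (\<iota> x)"
    using sign_symmetric(2)[of "sign_op T x" "x"] sign_symmetric(1)[of "sign_op T x" x]
    by (simp add: sign)
  then show ?thesis
    by (simp add: norm_sq_cinner flip: power2_eq_iff_nonneg)
qed

text \<open>\<open>T\<close> factors through \<open>\<iota>\<close> because \<open>T = |T|\<^sup>1\<^sup>/\<^sup>2 |T|\<^sup>1\<^sup>/\<^sup>2 sign T\<close>, where \<open>sign T\<close> is isometric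
  in the energy norm.\<close>

lemma factor_through_embedding:
  obtains L where "bounded_clinear L" "\<And>h. L (\<iota> h) = T h"
proof -
  define S where "S = sqrt_op (abs_op T)"
  obtain K where K: "\<And>x. norm (S x) \<le> K * norm x"
    unfolding S_def using bounded_clinear_bound[OF bounded_clinear_sqrt_abs] by metis
  have "norm (T h) \<le> K * norm (\<iota> h)" for h
  proof -
    have "T h = S (S (sign_op T h))"
      by (simp add: S_def sqrt_op_square positive_abs_op[OF T sym] sign)
    moreover have "norm (S (sign_op T h)) = norm (\<iota> h)"
      by (simp add: S_def norm_sign flip: norm_embedding)
    ultimately show ?thesis using K[of "S (sign_op T h)"] by simp
  qed
  from bounded_clinear_extension[OF clinear_embedding dense bounded_clinear_imp_clinear_on[OF T] this]
  show ?thesis using that by blast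
qed

lemma extended_sign:
  defines "J \<equiv> extend_by_continuity \<iota> (sign_op T)"
  shows fundamental_symmetry_sign: "fundamental_symmetry J"
    and cinner_extended_sign: "cinner (J (\<iota> x)) (\<iota> y) = cinner (T x) y"
proof -
  have "clinear_on UNIV (\<lambda>h. \<iota> (sign_op T h))"
    by (intro bounded_clinear_imp_clinear_on bounded_clinear_compose[OF bounded_clinear_embedding] sign)
  moreover have "norm (\<iota> (sign_op T h)) \<le> 1 * norm (\<iota> h)" for h
    by (simp add: norm_sign)
  ultimately obtain F where F: "bounded_clinear F" "\<And>h. F (\<iota> h) = \<iota> (sign_op T h)"
    using bounded_clinear_extension[OF clinear_embedding dense] by metis
  have "J = F"
    unfolding J_def
    by (intro extend_by_continuity_eq dense bounded_clinear_continuous F)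
  then have J: "bounded_clinear J" "\<And>h. J (\<iota> h) = \<iota> (sign_op T h)"
    using F by auto
  show "cinner (J (\<iota> x)) (\<iota> y) = cinner (T x) y"
    by (simp add: J sign_symmetric)
  note cont = bounded_clinear_continuous[OF J(1)]
  \<comment> \<open>Symmetry is known for two vectors from the range of \<open>\<iota>\<close>; it
    is extended by continuity in the first slot here and in the second slot afterwards.\<close>
  have 1: "cinner (J x) (\<iota> k) = cinner x (J (\<iota> k))" for x k
  proof -
    have "(\<lambda>x. cinner (J x) (\<iota> k)) = (\<lambda>x. cinner x (J (\<iota> k)))"
    proof (rule continuous_dense_ext[OF dense])
      show "cinner (J x) (\<iota> k) = cinner x (J (\<iota> k))" if "x \<in> range \<iota>" for x
        using that by (auto simp: J sign_symmetric)
    qed (intro continuous_intros cont)+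
    then show ?thesis by metis
  qed
  have 2: "cinner (J x) y = cinner x (J y)" for x y
  proof -
    have "(\<lambda>y. cinner (J x) y) = (\<lambda>y. cinner x (J y))"
    proof (rule continuous_dense_ext[OF dense])
      show "cinner (J x) y = cinner x (J y)" if "y \<in> range \<iota>" for y
        using that 1 by auto
    qed (intro continuous_intros cont)+
    then show ?thesis by metis
  qed
  have "(\<lambda>x. J (J x)) = (\<lambda>x. x)"
    by (rule continuous_dense_ext[OF dense bounded_clinear_continuous[OF bounded_clinear_compose[OF J(1) J(1)]]
          continuous_on_id])
      (auto simp: J sign)
  then show "fundamental_symmetry J"
    using J(1) 2 by (auto simp: fundamental_symmetry_def fun_eq_iff)
qed

end

section \<open>Boundary triplets\<close>

lemma im_part:
  assumes B: "bounded_clinear B"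
  shows bounded_clinear_im_part: "bounded_clinear (im_part B)"
    and im_part_symmetric: "cinner (im_part B x) y = cinner x (im_part B y)"
    and im_part_eq: "(2 * \<i>) *\<^sub>C im_part B x = B x - cadjoint B x"
proof -
  show "bounded_clinear (im_part B)"
    unfolding im_part_def
    by (intro bounded_clinear_cmult bounded_clinear_sub B bounded_clinear_cadjoint)
  show "cinner (im_part B x) y = cinner x (im_part B y)"
    by (simp add: im_part_def cinner_simps cinner_cadjoint[OF B] cinner_cadjoint_left[OF B]
        algebra_simps)
  show "(2 * \<i>) *\<^sub>C im_part B x = B x - cadjoint B x"
    by (simp add: im_part_def scaleC_scaleC)
qed

lemma cadjoint_cadjoint: "bounded_clinear B \<Longrightarrow> cadjoint (cadjoint B) = B"
  by (intro cadjoint_unique cinner_cadjoint_left)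

lemma boundary_tripletD:
  assumes "boundary_triplet A \<Gamma>\<^sub>0 \<Gamma>\<^sub>1"
  shows boundary_triplet_linear:
      "clinear_on (Domain (op_adjoint A)) \<Gamma>\<^sub>0" "clinear_on (Domain (op_adjoint A)) \<Gamma>\<^sub>1"
    and boundary_triplet_green: "(f, f') \<in> op_adjoint A \<Longrightarrow> (g, g') \<in> op_adjoint A \<Longrightarrow>
      cinner f' g - cinner f g' = cinner (\<Gamma>\<^sub>1 f) (\<Gamma>\<^sub>0 g) - cinner (\<Gamma>\<^sub>0 f) (\<Gamma>\<^sub>1 g)"
    and boundary_triplet_onto: "\<exists>f f'. (f, f') \<in> op_adjoint A \<and> \<Gamma>\<^sub>0 f = h \<and> \<Gamma>\<^sub>1 f = k"
proof -
  show "\<exists>f f'. (f, f') \<in> op_adjoint A \<and> \<Gamma>\<^sub>0 f = h \<and> \<Gamma>\<^sub>1 f = k"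
  proof -
    have "(k, h) \<in> (\<lambda>f. (\<Gamma>\<^sub>1 f, \<Gamma>\<^sub>0 f)) ` Domain (op_adjoint A)"
      using assms by (simp add: boundary_triplet_def)
    then show ?thesis by auto
  qed
qed (use assms in \<open>auto simp: boundary_triplet_def\<close>)

text \<open>Replacing \<open>\<Gamma>\<^sub>1\<close> by
  \<open>\<Gamma>\<^sub>1 - C \<Gamma>\<^sub>0\<close> on one side and by the same map with
  \<open>cadjoint C\<close> on the other adds two terms to Green's identity that cancel.\<close>

lemma dual_boundary_maps_bounded:
  assumes A: "closed_densely_defined_symmetric A" and triplet: "boundary_triplet A \<Gamma>\<^sub>0 \<Gamma>\<^sub>1"
    and C: "bounded_clinear C"
  shows "dual_boundary_maps A \<Gamma>\<^sub>0 (\<lambda>f. \<Gamma>\<^sub>1 f - C (\<Gamma>\<^sub>0 f)) \<Gamma>\<^sub>0 (\<lambda>f. \<Gamma>\<^sub>1 f - cadjoint C (\<Gamma>\<^sub>0 f))"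
proof
  have lin: "clinear_on (Domain (op_adjoint A)) (\<lambda>f. \<Gamma>\<^sub>1 f - D (\<Gamma>\<^sub>0 f))" if "bounded_clinear D" for D
    using boundary_triplet_linear[OF triplet] that
    by (auto simp: clinear_on_def bounded_clinear_add bounded_clinear_scaleC scaleC_diff_right)
  then show "clinear_on (Domain (op_adjoint A)) (\<lambda>f. \<Gamma>\<^sub>1 f - C (\<Gamma>\<^sub>0 f))"
    "clinear_on (Domain (op_adjoint A)) (\<lambda>f. \<Gamma>\<^sub>1 f - cadjoint C (\<Gamma>\<^sub>0 f))"
    using C bounded_clinear_cadjoint by blast+
  have "\<exists>f f'. (f, f') \<in> op_adjoint A \<and> \<Gamma>\<^sub>0 f = h \<and> \<Gamma>\<^sub>1 f - D (\<Gamma>\<^sub>0 f) = k" for h k D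
    using boundary_triplet_onto[OF triplet, of h "k + D h"] by force
  then show "\<exists>f f'. (f, f') \<in> op_adjoint A \<and> \<Gamma>\<^sub>0 f = h \<and> \<Gamma>\<^sub>1 f - C (\<Gamma>\<^sub>0 f) = k"
    "\<exists>f f'. (f, f') \<in> op_adjoint A \<and> \<Gamma>\<^sub>0 f = h \<and> \<Gamma>\<^sub>1 f - cadjoint C (\<Gamma>\<^sub>0 f) = k" for h k
    by blast+
qed (use A boundary_triplet_linear[OF triplet] boundary_triplet_green[OF triplet]
    in \<open>auto simp: cinner_diff_left cinner_diff_right cinner_cadjoint[OF C]\<close>)

text \<open>Exchanging the boundary maps reverses the sign of Green's form, which the minus
  restores. These maps are their own dual, reflecting the self-adjointness of
  \<open>ext_zero A \<Gamma>\<^sub>0\<close>.\<close>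

lemma dual_boundary_maps_swap:
  assumes A: "closed_densely_defined_symmetric A" and triplet: "boundary_triplet A \<Gamma>\<^sub>0 \<Gamma>\<^sub>1"
  shows "dual_boundary_maps A (\<lambda>f. - \<Gamma>\<^sub>1 f) \<Gamma>\<^sub>0 (\<lambda>f. - \<Gamma>\<^sub>1 f) \<Gamma>\<^sub>0"
proof
  show "clinear_on (Domain (op_adjoint A)) (\<lambda>f. - \<Gamma>\<^sub>1 f)"
    using boundary_triplet_linear[OF triplet] by (auto simp: clinear_on_def)
  show "\<exists>f f'. (f, f') \<in> op_adjoint A \<and> - \<Gamma>\<^sub>1 f = h \<and> \<Gamma>\<^sub>0 f = k" for h k
    using boundary_triplet_onto[OF triplet, of k "- h"] by force
qed (use A boundary_triplet_linear[OF triplet] boundary_triplet_green[OF triplet] in auto)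

lemma weyl_function:
  assumes A: "closed_densely_defined_symmetric A" and triplet: "boundary_triplet A \<Gamma>\<^sub>0 \<Gamma>\<^sub>1"
    and z: "z \<in> resolvent_set (ext_zero A \<Gamma>\<^sub>0)"
  shows bounded_clinear_weyl_function: "bounded_clinear (weyl_function A \<Gamma>\<^sub>0 \<Gamma>\<^sub>1 z)"
    and weyl_function_eq: "(u, z *\<^sub>C u) \<in> op_adjoint A \<Longrightarrow> weyl_function A \<Gamma>\<^sub>0 \<Gamma>\<^sub>1 z (\<Gamma>\<^sub>0 u) = \<Gamma>\<^sub>1 u"
    and defect_onto: "\<exists>u. (u, z *\<^sub>C u) \<in> op_adjoint A \<and> \<Gamma>\<^sub>0 u = h"
proof -
  interpret dual_boundary_maps A "\<lambda>f. - \<Gamma>\<^sub>1 f" \<Gamma>\<^sub>0 "\<lambda>f. - \<Gamma>\<^sub>1 f" \<Gamma>\<^sub>0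
    by (rule dual_boundary_maps_swap[OF A triplet])
  show ex: "\<exists>u. (u, z *\<^sub>C u) \<in> op_adjoint A \<and> \<Gamma>\<^sub>0 u = h" for h
    using defect_solution[OF z] by blast
  have "bounded_clinear (\<lambda>h. - transfer z h)"
    by (intro bounded_clinear_uminus bounded_clinear_transfer z)
  moreover have "- transfer z (\<Gamma>\<^sub>0 f) = \<Gamma>\<^sub>1 f" if "(f, z *\<^sub>C f) \<in> op_adjoint A" for f
    using defect_solution_unique[OF z that] by (simp add: transfer_def)
  ultimately have M: "bounded_clinear (\<lambda>h. - transfer z h)"
      "\<forall>f\<in>op_kernel (op_adjoint A) z. - transfer z (\<Gamma>\<^sub>0 f) = \<Gamma>\<^sub>1 f"
    by (simp_all add: op_kernel_def)
  \<comment> \<open>The kernel is mapped onto the whole boundary space, so its boundary values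
    determine the operator and the description is unique.\<close>
  have "weyl_function A \<Gamma>\<^sub>0 \<Gamma>\<^sub>1 z = (\<lambda>h. - transfer z h)"
    unfolding weyl_function_def
  proof (rule the_equality)
    fix T assume T: "bounded_clinear T \<and> (\<forall>f\<in>op_kernel (op_adjoint A) z. T (\<Gamma>\<^sub>0 f) = \<Gamma>\<^sub>1 f)"
    show "T = (\<lambda>h. - transfer z h)"
    proof
      fix h
      obtain u where "(u, z *\<^sub>C u) \<in> op_adjoint A" "\<Gamma>\<^sub>0 u = h" using ex by blast
      then show "T h = - transfer z h" using T M(2) by (auto simp: op_kernel_def)
    qed
  qed (use M in blast)
  with M show "bounded_clinear (weyl_function A \<Gamma>\<^sub>0 \<Gamma>\<^sub>1 z)"
    "(u, z *\<^sub>C u) \<in> op_adjoint A \<Longrightarrow> weyl_function A \<Gamma>\<^sub>0 \<Gamma>\<^sub>1 z (\<Gamma>\<^sub>0 u) = \<Gamma>\<^sub>1 u"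
    by (simp_all add: op_kernel_def)
qed

text \<open>The negative of the adjoint extension extends \<open>op_neg A\<close>, so being proper
  has to be measured against the adjoint of \<open>op_neg A\<close>.\<close>

lemma op_adjoint_op_neg: "op_adjoint (op_neg A) = op_neg (op_adjoint A)"
proof (intro set_eqI iffI; clarify)
  fix g g' assume *: "(g, g') \<in> op_adjoint (op_neg A)"
  have "cinner f' g = cinner f (- g')" if "(f, f') \<in> A" for f f'
  proof -
    have "(f, - f') \<in> op_neg A" using that by (auto simp: op_neg_def)
    with * have "cinner (- f') g = cinner f g'" unfolding op_adjoint_def by blast
    then show ?thesis by (metis cinner_minus_left cinner_minus_right minus_minus)
  qed
  then have "(g, - g') \<in> op_adjoint A" unfolding op_adjoint_def by blast
  then show "(g, g') \<in> op_neg (op_adjoint A)" by (force simp: op_neg_def)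
next
  fix g g' assume "(g, g') \<in> op_neg (op_adjoint A)"
  then show "(g, g') \<in> op_adjoint (op_neg A)"
    by (auto simp: op_neg_def op_adjoint_def)
qed

lemma proper_extension_op_neg:
  assumes "proper_extension A T"
  shows "proper_extension (op_neg A) (op_neg T)"
proof -
  have T: "linear_operator T" and "A \<subseteq> T" "T \<subseteq> op_adjoint A"
    using assms by (auto simp: proper_extension_def)
  have "linear_operator (op_neg T)"
    unfolding linear_operator_def
  proof (intro conjI)
    show "single_valued (op_neg T)"
      using linear_operator_unique[OF T] by (auto simp: single_valued_def op_neg_def)
    show "(0, 0) \<in> op_neg T"
      using linear_operator_zero[OF T] by (force simp: op_neg_def)
    show "\<forall>(f, f')\<in>op_neg T. \<forall>(g, g')\<in>op_neg T. (f + g, f' + g') \<in> op_neg T"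
      using linear_operator_add[OF T] by (force simp: op_neg_def)
    show "\<forall>c. \<forall>(f, f')\<in>op_neg T. (c *\<^sub>C f, c *\<^sub>C f') \<in> op_neg T"
      using linear_operator_scaleC[OF T] by (force simp: op_neg_def)
  qed
  then show ?thesis
    using \<open>A \<subseteq> T\<close> \<open>T \<subseteq> op_adjoint A\<close>
    by (auto simp: proper_extension_def op_adjoint_op_neg) (auto simp: op_neg_def)
qed

theorem theorem6p2:
  fixes A AB ABstar A0 :: "('a::complex_hilbert \<times> 'a) set"
    and \<Gamma>\<^sub>0 \<Gamma>\<^sub>1 :: "'a \<Rightarrow> 'h::complex_hilbert"
    and M :: "complex \<Rightarrow> 'h \<Rightarrow> 'h"
    and B B\<^sub>I :: "'h \<Rightarrow> 'h"
    and \<iota> :: "'h \<Rightarrow> 'e::complex_hilbert"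
    and J :: "'e \<Rightarrow> 'e"
    and \<Gamma> \<Gamma>' :: "'a \<Rightarrow> 'e"
    and W :: "complex \<Rightarrow> 'e \<Rightarrow> 'e"
  assumes separable: "\<exists>D :: 'a set. countable D \<and> closure D = UNIV"
    and A: "closed_densely_defined_symmetric A"
    and deficiency: "equal_deficiency_indices A"
    and triplet: "boundary_triplet A \<Gamma>\<^sub>0 \<Gamma>\<^sub>1"
    and M: "M = weyl_function A \<Gamma>\<^sub>0 \<Gamma>\<^sub>1"
    and B: "bounded_clinear B"
    and BI: "B\<^sub>I = im_part B"
    and ker_BI: "{h. B\<^sub>I h = 0} = {0}"
    and A0: "A0 = ext_zero A \<Gamma>\<^sub>0"
    and AB: "AB = ext_of A \<Gamma>\<^sub>0 \<Gamma>\<^sub>1 B"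
    and ABstar: "ABstar = ext_of A \<Gamma>\<^sub>0 \<Gamma>\<^sub>1 (cadjoint B)"
    and completion: "is_completion (\<lambda>h. norm (sqrt_op (abs_op B\<^sub>I) h)) \<iota>"
    and J: "J = extend_by_continuity \<iota> (sign_op B\<^sub>I)"
    and \<Gamma>: "\<Gamma> = (\<lambda>f. \<iota> (\<Gamma>\<^sub>0 f))"
    and \<Gamma>': "\<Gamma>' = (\<lambda>f. \<iota> (\<Gamma>\<^sub>0 f))"
    and W: "W = characteristic_function AB \<Gamma> \<Gamma>'"
  shows "op_adjoint AB = ABstar \<and> disjoint_extensions A AB ABstar \<and>
         boundary_operator A AB J \<Gamma> \<and>
         boundary_operator (op_neg A) (op_neg (op_adjoint AB)) J \<Gamma>' \<and>
         (\<forall>z\<in>resolvent_set ABstar. is_characteristic_value AB \<Gamma> \<Gamma>' z (W z)) \<and>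
         (\<forall>z\<in>resolvent_set ABstar. bounded_clinear (W z)) \<and>
         op_holomorphic_on W (resolvent_set ABstar) \<and>
         (\<forall>z\<in>resolvent_set ABstar \<inter> resolvent_set A0.
            bij (\<lambda>h. cadjoint B h - M z h) \<and>
            bounded_clinear (inv (\<lambda>h. cadjoint B h - M z h)) \<and>
            (\<forall>h. W z (\<iota> h) = \<iota> (inv (\<lambda>h. cadjoint B h - M z h) (B h - M z h))))"
proof -
  \<comment> \<open>\<open>Y\<close> belongs to \<open>cadjoint B\<close> because the points
    \<open>z\<close> range over the resolvent set of \<open>ABstar\<close>; \<open>Y'\<close>
    describes its dual partner \<open>AB\<close>.\<close>
  define Y Y' where "Y = (\<lambda>f. \<Gamma>\<^sub>1 f - cadjoint B (\<Gamma>\<^sub>0 f))" and "Y' = (\<lambda>f. \<Gamma>\<^sub>1 f - B (\<Gamma>\<^sub>0 f))"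
  interpret ext: dual_boundary_maps A \<Gamma>\<^sub>0 Y \<Gamma>\<^sub>0 Y'
    using dual_boundary_maps_bounded[OF A triplet bounded_clinear_cadjoint[OF B]]
    by (simp add: cadjoint_cadjoint[OF B] Y_def Y'_def)
  interpret dual: dual_boundary_maps A \<Gamma>\<^sub>0 Y' \<Gamma>\<^sub>0 Y by (rule ext.dual)
  interpret energy_completion B\<^sub>I \<iota>
    using bounded_clinear_im_part[OF B] im_part_symmetric[OF B] ker_BI completion
    by unfold_locales (auto simp: BI)
  have AB_eq: "AB = ext_zero A Y'" and ABstar_eq: "ABstar = ext_zero A Y"
    by (simp_all add: AB ABstar ext_of_def ext_zero_def Y_def Y'_def)
  have BI2: "(2 * \<i>) *\<^sub>C B\<^sub>I h = B h - cadjoint B h" for h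
    unfolding BI by (rule im_part_eq[OF B])
  have adj: "op_adjoint AB = ABstar"
    unfolding AB_eq ABstar_eq by (rule dual.op_adjoint_ext_zero)
  have AB_mem: "(f, f') \<in> op_adjoint A" "\<Gamma>\<^sub>1 f = B (\<Gamma>\<^sub>0 f)" if "(f, f') \<in> AB" for f f'
    using that by (auto simp: AB_eq ext_zero_def Y'_def)
  have ABstar_mem: "(f, f') \<in> op_adjoint A" "\<Gamma>\<^sub>1 f = cadjoint B (\<Gamma>\<^sub>0 f)" if "(f, f') \<in> ABstar" for f f'
    using that by (auto simp: ABstar_eq ext_zero_def Y_def)
  have \<Gamma>_AB: "\<exists>f f'. (f, f') \<in> AB \<and> \<Gamma>\<^sub>0 f = h" and \<Gamma>_ABstar: "\<exists>f f'. (f, f') \<in> ABstar \<and> \<Gamma>\<^sub>0 f = h" for h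
    using ext.onto[of h 0] dual.onto[of h 0] by (auto simp: AB_eq ABstar_eq ext_zero_def)

  \<comment> \<open>Disjointness and the two boundary operators\<close>
  have disjoint: "disjoint_extensions A AB ABstar"
    unfolding disjoint_extensions_def
  proof (intro equalityI subsetI)
    fix f assume "f \<in> Domain AB \<inter> Domain ABstar"
    then obtain f' f'' where f: "(f, f') \<in> AB" "(f, f'') \<in> ABstar" by blast
    have "(2 * \<i>) *\<^sub>C B\<^sub>I (\<Gamma>\<^sub>0 f) = 0"
      using AB_mem(2)[OF f(1)] ABstar_mem(2)[OF f(2)] by (simp add: BI2)
    then have "norm (B\<^sub>I (\<Gamma>\<^sub>0 f)) = 0"
      using norm_scaleC[of "2 * \<i>" "B\<^sub>I (\<Gamma>\<^sub>0 f)"] by simp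
    then have "\<Gamma>\<^sub>0 f = 0" using inj by simp
    then have "(f, f') \<in> A"
      using f(1) by (simp add: dual.mem_A_iff AB_eq ext_zero_def)
    then show "f \<in> Domain A" by blast
  next
    fix f assume "f \<in> Domain A"
    then obtain f' where "(f, f') \<in> A" by blast
    then have "(f, f') \<in> AB" "(f, f') \<in> ABstar"
      using ext.mem_A_iff dual.mem_A_iff by (auto simp: AB_eq ABstar_eq ext_zero_def)
    then show "f \<in> Domain AB \<inter> Domain ABstar" by blast
  qed

  have clin: "clinear_on S (\<lambda>f. \<iota> (\<Gamma>\<^sub>0 f))" if "S \<subseteq> Domain (op_adjoint A)" for S
    using subsetD[OF that] ext.linear(1) clinear_embedding by (simp add: clinear_on_def)
  have bo: "boundary_operator A AB J \<Gamma>"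
    unfolding boundary_operator_def
  proof (intro conjI)
    show "proper_extension A AB" unfolding AB_eq by (rule dual.proper_extension_ext_zero)
    show "fundamental_symmetry J" unfolding J by (rule fundamental_symmetry_sign)
    show "clinear_on (Domain AB) \<Gamma>" unfolding \<Gamma> using AB_mem(1) by (intro clin) blast
    have "\<iota> h \<in> \<Gamma> ` Domain AB" for h using \<Gamma>_AB[of h] unfolding \<Gamma> by blast
    then have "\<Gamma> ` Domain AB = range \<iota>" by (auto simp: \<Gamma>)
    then show "closure (\<Gamma> ` Domain AB) = UNIV" using dense by simp
    have "cinner f' g - cinner f g' = 2 * \<i> * cinner (J (\<Gamma> f)) (\<Gamma> g)"
      if fg: "(f, f') \<in> AB" "(g, g') \<in> AB" for f f' g g'
    proof -
      have "cinner f' g - cinner f g' = cinner (B (\<Gamma>\<^sub>0 f)) (\<Gamma>\<^sub>0 g) - cinner (\<Gamma>\<^sub>0 f) (B (\<Gamma>\<^sub>0 g))"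
        using boundary_triplet_green[OF triplet AB_mem(1)[OF fg(1)] AB_mem(1)[OF fg(2)]]
        by (simp add: AB_mem(2)[OF fg(1)] AB_mem(2)[OF fg(2)])
      also have "\<dots> = cinner ((2 * \<i>) *\<^sub>C B\<^sub>I (\<Gamma>\<^sub>0 f)) (\<Gamma>\<^sub>0 g)"
        by (simp only: BI2 cinner_diff_left cinner_cadjoint_left[OF B])
      finally show ?thesis
        by (simp add: cinner_scaleC_left \<Gamma> J cinner_extended_sign)
    qed
    then show "\<forall>(f, f')\<in>AB. \<forall>(g, g')\<in>AB. cinner f' g - cinner f g' = 2 * \<i> * cinner (J (\<Gamma> f)) (\<Gamma> g)"
      by blast
  qed

  have bo': "boundary_operator (op_neg A) (op_neg ABstar) J \<Gamma>'"
    unfolding boundary_operator_def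
  proof (intro conjI)
    have dom: "Domain (op_neg ABstar) = Domain ABstar" by (auto simp: op_neg_def)
    show "proper_extension (op_neg A) (op_neg ABstar)"
      unfolding ABstar_eq by (intro proper_extension_op_neg ext.proper_extension_ext_zero)
    show "fundamental_symmetry J" unfolding J by (rule fundamental_symmetry_sign)
    show "clinear_on (Domain (op_neg ABstar)) \<Gamma>'"
      unfolding \<Gamma>' dom using ABstar_mem(1) by (intro clin) blast
    have "\<iota> h \<in> \<Gamma>' ` Domain ABstar" for h using \<Gamma>_ABstar[of h] unfolding \<Gamma>' by blast
    then have "\<Gamma>' ` Domain ABstar = range \<iota>" by (auto simp: \<Gamma>')
    then show "closure (\<Gamma>' ` Domain (op_neg ABstar)) = UNIV" using dense dom by simp
    have "cinner (- f') g - cinner f (- g') = 2 * \<i> * cinner (J (\<Gamma>' f)) (\<Gamma>' g)"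
      if fg: "(f, f') \<in> ABstar" "(g, g') \<in> ABstar" for f f' g g'
    proof -
      \<comment> \<open>Passing to \<open>ABstar\<close> replaces \<open>B\<close> by its adjoint
        and reverses the sign of the boundary form; the minus in front of the operator reverses it
        again, so the same \<open>J\<close> serves.\<close>
      have "cinner (- f') g - cinner f (- g') = - (cinner f' g - cinner f g')" by simp
      also have "\<dots> = cinner (\<Gamma>\<^sub>0 f) (cadjoint B (\<Gamma>\<^sub>0 g)) - cinner (cadjoint B (\<Gamma>\<^sub>0 f)) (\<Gamma>\<^sub>0 g)"
        unfolding boundary_triplet_green[OF triplet ABstar_mem(1)[OF fg(1)] ABstar_mem(1)[OF fg(2)]]
        by (simp add: ABstar_mem(2)[OF fg(1)] ABstar_mem(2)[OF fg(2)])
      also have "\<dots> = cinner ((2 * \<i>) *\<^sub>C B\<^sub>I (\<Gamma>\<^sub>0 f)) (\<Gamma>\<^sub>0 g)"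
        by (simp only: BI2 cinner_diff_left cinner_cadjoint[OF B, symmetric])
      finally show ?thesis
        by (simp add: cinner_scaleC_left \<Gamma>' J cinner_extended_sign)
    qed
    then show "\<forall>(f, f')\<in>op_neg ABstar. \<forall>(g, g')\<in>op_neg ABstar.
        cinner f' g - cinner f g' = 2 * \<i> * cinner (J (\<Gamma>' f)) (\<Gamma>' g)"
      by (auto simp: op_neg_def)
  qed

  \<comment> \<open>The characteristic function and its holomorphy\<close>
  obtain L where L: "bounded_clinear L" "\<And>h. L (\<iota> h) = B\<^sub>I h"
    using factor_through_embedding by blast
  define V where "V z x = x + (- 2 * \<i>) *\<^sub>C \<iota> (ext.transfer z (L x))" for z x
  have bV: "bounded_clinear (V z)" if "z \<in> resolvent_set ABstar" for z
    unfolding V_def using that unfolding ABstar_eq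
    by (intro bounded_clinear_plus bounded_clinear_ident bounded_clinear_cmult
        bounded_clinear_compose[OF bounded_clinear_embedding]
        bounded_clinear_compose[OF ext.bounded_clinear_transfer] L)
  have step: "\<Gamma>\<^sub>0 g = \<Gamma>\<^sub>0 f + (- 2 * \<i>) *\<^sub>C ext.transfer z (B\<^sub>I (\<Gamma>\<^sub>0 f))"
    if z: "z \<in> resolvent_set ABstar" and f: "(f, f') \<in> AB" and g: "(g, g') \<in> ABstar"
      and eq: "g' - z *\<^sub>C g = f' - z *\<^sub>C f" for z f f' g g'
  proof -
    note z' = z[unfolded ABstar_eq]
    define u where "u = g - f"
    have "g' - f' = z *\<^sub>C (g - f)"
      using eq by (simp add: scaleC_diff_right algebra_simps)
    then have u: "(u, z *\<^sub>C u) \<in> op_adjoint A"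
      using linear_operator_diff[OF ext.linear_op_adjoint ABstar_mem(1)[OF g] AB_mem(1)[OF f]]
      by (simp add: u_def)
    have "Y u = Y g - Y f" "\<Gamma>\<^sub>0 u = \<Gamma>\<^sub>0 g - \<Gamma>\<^sub>0 f"
      unfolding u_def using ext.maps_diff[OF ABstar_mem(1)[OF g] AB_mem(1)[OF f]] by auto
    moreover have "Y g = 0" "Y f = (2 * \<i>) *\<^sub>C B\<^sub>I (\<Gamma>\<^sub>0 f)"
      by (simp_all add: Y_def BI2 ABstar_mem(2)[OF g] AB_mem(2)[OF f])
    ultimately have "ext.transfer z ((- 2 * \<i>) *\<^sub>C B\<^sub>I (\<Gamma>\<^sub>0 f)) = \<Gamma>\<^sub>0 g - \<Gamma>\<^sub>0 f"
      using ext.defect_solution_unique[OF z' u] by (simp add: ext.transfer_def)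
    then show ?thesis
      by (simp add: bounded_clinearD(4,6)[OF ext.bounded_clinear_transfer[OF z']] algebra_simps)
  qed
  have V_char: "is_characteristic_value AB \<Gamma> \<Gamma>' z (V z)" if z: "z \<in> resolvent_set ABstar" for z
  proof -
    have "V z (\<Gamma> f) = \<Gamma>' g" if "(f, f') \<in> AB" "(g, g') \<in> ABstar" "g' - z *\<^sub>C g = f' - z *\<^sub>C f"
      for f f' g g'
      using step[OF z that]
      by (simp add: V_def \<Gamma> \<Gamma>' L bounded_clinearD(2,3,4,6)[OF bounded_clinear_embedding])
    then show ?thesis
      unfolding is_characteristic_value_def adj using bounded_clinear_continuous[OF bV[OF z]] by blast
  qed
  have W_eq: "W z = V z" if z: "z \<in> resolvent_set ABstar" for z
    unfolding W characteristic_function_def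
  proof (rule the_equality)
    show "is_characteristic_value AB \<Gamma> \<Gamma>' z (V z)" by (rule V_char[OF z])
    fix U assume U: "is_characteristic_value AB \<Gamma> \<Gamma>' z U"
    show "U = V z"
    proof (rule continuous_dense_ext[OF dense])
      show "continuous_on UNIV U" "continuous_on UNIV (V z)"
        using U V_char[OF z] by (auto simp: is_characteristic_value_def)
      fix x assume "x \<in> range \<iota>"
      then obtain h where "x = \<iota> h" by blast
      then obtain f f' where f: "(f, f') \<in> AB" "x = \<Gamma> f"
        using \<Gamma>_AB[of h] unfolding \<Gamma> by blast
      \<comment> \<open>The characterizing condition fixes a value only at those \<open>f\<close>
        for which the equation has a solution; the resolvent of \<open>ABstar\<close> provides one
        for every \<open>f\<close>.\<close>
      define g where "g = resolvent ABstar z (f' - z *\<^sub>C f)"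
      have g: "(g, (f' - z *\<^sub>C f) + z *\<^sub>C g) \<in> op_adjoint AB"
        unfolding adj g_def by (rule resolvent_mem[OF z])
      have "U' (\<Gamma> f) = \<Gamma>' g" if "is_characteristic_value AB \<Gamma> \<Gamma>' z U'" for U'
        using that f(1) g unfolding is_characteristic_value_def by fastforce
      from this[OF U] this[OF V_char[OF z]] show "U x = V z x" by (simp add: f(2))
    qed
  qed
  have hol: "op_holomorphic_on W (resolvent_set ABstar)"
  proof (rule op_holomorphic_on_affine)
    show "op_holomorphic_on ext.transfer (resolvent_set ABstar)"
      unfolding ABstar_eq by (rule ext.op_holomorphic_on_transfer)
    show "bounded_clinear (\<lambda>h. (- 2 * \<i>) *\<^sub>C \<iota> h)"
      by (intro bounded_clinear_cmult bounded_clinear_embedding)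
    show "W z x = x + (- 2 * \<i>) *\<^sub>C \<iota> (ext.transfer z (L x))" if "z \<in> resolvent_set ABstar" for z x
      by (simp add: W_eq[OF that] V_def)
  qed (intro L bounded_clinear_ident)+

  \<comment> \<open>Comparison with the Weyl function\<close>
  have formula: "bij N \<and> bounded_clinear (inv N) \<and> (\<forall>h. W z (\<iota> h) = \<iota> (inv N (B h - M z h)))"
    if z: "z \<in> resolvent_set ABstar" and z0: "z \<in> resolvent_set A0"
      and N: "N = (\<lambda>h. cadjoint B h - M z h)" for z N
  proof -
    note z' = z[unfolded ABstar_eq] and z0' = z0[unfolded A0]
    define Q where "Q = ext.transfer z"
    have Q: "bounded_clinear Q" unfolding Q_def by (rule ext.bounded_clinear_transfer[OF z'])
    have bN: "bounded_clinear N"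
      unfolding N M
      by (intro bounded_clinear_sub bounded_clinear_cadjoint B bounded_clinear_weyl_function[OF A triplet z0'])
    \<comment> \<open>At a common point of both resolvent sets, \<open>\<Gamma>\<^sub>0\<close> and
      \<open>Y\<close> each map the kernel bijectively onto the boundary space. As \<open>N\<close>
      takes one to minus the other, it is invertible with inverse \<open>- Q\<close>.\<close>
    have N\<Gamma>: "N (\<Gamma>\<^sub>0 u) = - Y u" if "(u, z *\<^sub>C u) \<in> op_adjoint A" for u
      using weyl_function_eq[OF A triplet z0' that] by (simp add: N M Y_def)
    have right: "N (- Q k) = k" for k
      using N\<Gamma>[OF ext.defect_solution(1)[OF z', of k]] ext.defect_solution(2)[OF z', of k]
      by (simp add: Q_def ext.transfer_def bounded_clinear_minus[OF bN])
    have left: "- Q (N h) = h" for h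
    proof -
      obtain u where u: "(u, z *\<^sub>C u) \<in> op_adjoint A" "\<Gamma>\<^sub>0 u = h"
        using defect_onto[OF A triplet z0'] by blast
      have "Q (Y u) = h"
        unfolding Q_def ext.transfer_def ext.defect_solution_unique[OF z' u(1)] by (rule u(2))
      then show ?thesis
        using N\<Gamma>[OF u(1)] u(2) by (simp add: bounded_clinear_minus[OF Q])
    qed
    have "bij N" by (rule o_bij[of "\<lambda>k. - Q k"]) (auto simp: fun_eq_iff left right)
    moreover have inv: "inv N = (\<lambda>k. - Q k)" by (rule inv_equality) (rule left right)+
    moreover have "W z (\<iota> h) = \<iota> (- Q (B h - M z h))" for h
    proof -
      \<comment> \<open>Splitting off \<open>N\<close> turns the product with the inverse into the
        identity plus the correction by \<open>B\<^sub>I\<close>, the shape in which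
        \<open>V\<close> is given.\<close>
      have "B h - M z h = N h + (2 * \<i>) *\<^sub>C B\<^sub>I h" by (simp add: N BI2)
      then have "- Q (B h - M z h) = h + (- 2 * \<i>) *\<^sub>C Q (B\<^sub>I h)"
        using left[of h] by (simp add: bounded_clinearD(2,6)[OF Q])
      then show ?thesis
        by (simp add: W_eq[OF z] V_def L Q_def bounded_clinearD(2,3,4,6)[OF bounded_clinear_embedding])
    qed
    ultimately show ?thesis using bounded_clinear_uminus[OF Q] by simp
  qed
  show ?thesis
    unfolding adj
    using disjoint bo bo' V_char W_eq bV hol formula by (auto simp: adj)
qed

end
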